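(* Let $d\ge1$, let $\mathcal{X}\subset\mathbb{R}^d$ be an open, connected, bounded set with Lipschitz boundary, let $0<s<1$, and suppose the design density $g$ is uniform on $\mathcal{X}$. Consider the regression model $Y_i=f(X_i)+\varepsilon_i$, $i=1,\dots,n$, described in the context, with $f\in H^s(\mathcal{X};M)$, $M>0$. Then $n^{-\frac{2s}{2s+d}}$ is a lower minimax rate of convergence; in particular, there exists a constant $C_1>0$ independent of $M$ and $n$ such that $$\liminf_{n\to\infty}\ \inf_{\hat f_n}\ \sup_{f\in H^s(\mathcal{X};M)}\ \frac{\mathbb{E}\|\hat f_n-f\|^2}{M^{\frac{2d}{2s+d}}\,n^{-\frac{2s}{2s+d}}}\ \ge\ C_1>0,$$ where the infimum is over all estimators $\hat f_n$ based on $(X_1,Y_1),\dots,(X_n,Y_n)$.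
   Context: Regression model: $X_1,\dots,X_n$ are i.i.d. with density $g$ on $\mathcal{X}$; $\varepsilon_1,\dots,\varepsilon_n$ are i.i.d. $N(0,1)$, independent of the $X_i$'s; $Y_i=f(X_i)+\varepsilon_i$. Risk: for an estimator $\hat f_n$ (a measurable function of the data, giving a function on $\mathcal{X}$), the integrated mean-squared estimation error $\mathbb{E}\|\hat f_n-f\|^2$ is the expectation over the data of $\|\hat f_n-f\|^2=\int_{\mathcal{X}}(\hat f_n(x)-f(x))^2g(x)\,dx$. Fractional Sobolev space: for $0<s<1$, $H^s(\mathcal{X})$ is the set of $u\in L^2(\mathcal{X})$ with $$|u|_{H^s(\mathcal{X})}^2:=\int_{\mathcal{X}\times\mathcal{X}}\frac{|u(x)-u(y)|^2}{\|x-y\|^{d+2s}}\,dx\,dy<\infty,$$ where $\|x-y\|$ is the Euclidean distance, with norm $\|u\|_{H^s(\mathcal{X})}=\left(\int_{\mathcal{X}}u^2(x)\,dx+|u|^2_{H^s(\mathcal{X})}\right)^{1/2}$. The ball of radius $M$ is $H^s(\mathcal{X};M)=\{u:\|u\|_{H^s(\mathcal{X})}\le M\}$. *)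

theory Defs
  imports "HOL-Probability.Probability"
begin

text \<open>
  Near each boundary point, and after a rotation, \<open>X\<close> is the strict epigraph of a Lipschitz
  function. The rotation is encoded by the unit vector \<open>e\<close> of the vertical axis: the vertical
  coordinate of \<open>x\<close> is \<open>x \<bullet> e\<close>, and \<open>x - (x \<bullet> e) *\<^sub>R e\<close> is its projection onto the hyperplane
  orthogonal to \<open>e\<close>, on which \<open>\<phi>\<close> lives. In dimension one that hyperplane is \<open>{0}\<close>.
\<close>
definition lipschitz_boundary :: "'a::euclidean_space set \<Rightarrow> bool" where
  "lipschitz_boundary X \<longleftrightarrow>
    (\<forall>p\<in>frontier X. \<exists>r>0. \<exists>e L \<phi>. norm e = 1 \<and> L-lipschitz_on {y. y \<bullet> e = 0} \<phi> \<and>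
       X \<inter> ball p r = {x \<in> ball p r. \<phi> (x - (x \<bullet> e) *\<^sub>R e) < x \<bullet> e})"

section \<open>Fractional Sobolev spaces\<close>

text \<open>
  Functions on \<open>X\<close> are represented by functions on the whole space whose values outside \<open>X\<close> are
  irrelevant. As every class in \<open>L\<^sup>2(X)\<close> has a Borel representative, only Borel functions
  are used. The junk value \<open>0 / 0 = 0\<close> in the integrand below only concerns the diagonal, a null
  set.
\<close>
definition gagliardo_sq :: "real \<Rightarrow> 'a::euclidean_space set \<Rightarrow> ('a \<Rightarrow> real) \<Rightarrow> ennreal" where
  "gagliardo_sq s X u =
    (\<integral>\<^sup>+ (x, y). ennreal (\<bar>u x - u y\<bar>\<^sup>2 / norm (x - y) powr (real DIM('a) + 2 * s))
       \<partial>(restrict_space lborel X \<Otimes>\<^sub>M restrict_space lborel X))"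

definition L2_sq :: "'a::euclidean_space set \<Rightarrow> ('a \<Rightarrow> real) \<Rightarrow> ennreal" where
  "L2_sq X u = (\<integral>\<^sup>+ x. ennreal ((u x)\<^sup>2) \<partial>restrict_space lborel X)"

definition sobolev_space :: "real \<Rightarrow> 'a::euclidean_space set \<Rightarrow> ('a \<Rightarrow> real) set" where
  "sobolev_space s X =
    {u \<in> borel_measurable (restrict_space borel X). L2_sq X u < \<infinity> \<and> gagliardo_sq s X u < \<infinity>}"

definition sobolev_norm :: "real \<Rightarrow> 'a::euclidean_space set \<Rightarrow> ('a \<Rightarrow> real) \<Rightarrow> real" where
  "sobolev_norm s X u = sqrt (enn2real (L2_sq X u + gagliardo_sq s X u))"

definition sobolev_ball :: "real \<Rightarrow> 'a::euclidean_space set \<Rightarrow> real \<Rightarrow> ('a \<Rightarrow> real) set" where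
  "sobolev_ball s X M = {u \<in> sobolev_space s X. sobolev_norm s X u \<le> M}"

section \<open>The regression model\<close>

definition uniform_density_on :: "'a::euclidean_space set \<Rightarrow> 'a \<Rightarrow> real" where
  "uniform_density_on X x = indicator X x / measure lborel X"

definition design_law :: "'a::euclidean_space set \<Rightarrow> ('a \<Rightarrow> real) \<Rightarrow> 'a measure" where
  "design_law X g = density (restrict_space lborel X) (\<lambda>x. ennreal (g x))"

text \<open>
  The joint law of \<open>\<omega> = ((X\<^sub>i, \<epsilon>\<^sub>i))\<close> for \<open>i < n\<close>: all coordinates independent, each \<open>X\<^sub>i\<close> with
  density \<open>g\<close> on \<open>X\<close> and each \<open>\<epsilon>\<^sub>i\<close> standard normal. Indices run from \<open>0\<close> to \<open>n - 1\<close>.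
\<close>
definition design_noise_law ::
    "'a::euclidean_space set \<Rightarrow> ('a \<Rightarrow> real) \<Rightarrow> nat \<Rightarrow> (nat \<Rightarrow> 'a \<times> real) measure" where
  "design_noise_law X g n =
    (\<Pi>\<^sub>M i\<in>{..<n}. design_law X g \<Otimes>\<^sub>M density lborel (\<lambda>t. ennreal (std_normal_density t)))"

definition observations ::
    "nat \<Rightarrow> ('a \<Rightarrow> real) \<Rightarrow> (nat \<Rightarrow> 'a \<times> real) \<Rightarrow> nat \<Rightarrow> 'a \<times> real" where
  "observations n f \<omega> = (\<lambda>i\<in>{..<n}. (fst (\<omega> i), f (fst (\<omega> i)) + snd (\<omega> i)))"

text \<open>
  An estimator maps a sample \<open>((X\<^sub>i, Y\<^sub>i))\<close> to a function on \<open>X\<close>, measurably in the sample and the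
  evaluation point jointly.
\<close>
definition estimators ::
    "'a::euclidean_space set \<Rightarrow> nat \<Rightarrow> ((nat \<Rightarrow> 'a \<times> real) \<Rightarrow> 'a \<Rightarrow> real) set" where
  "estimators X n =
    {fhat. (\<lambda>(D, x). fhat D x) \<in> borel_measurable
       ((\<Pi>\<^sub>M i\<in>{..<n}. restrict_space borel X \<Otimes>\<^sub>M borel) \<Otimes>\<^sub>M restrict_space borel X)}"

text \<open>The risk takes values in \<^typ>\<open>ennreal\<close>; estimators of infinite risk are allowed.\<close>
definition risk ::
    "'a::euclidean_space set \<Rightarrow> ('a \<Rightarrow> real) \<Rightarrow> nat \<Rightarrow>
      ((nat \<Rightarrow> 'a \<times> real) \<Rightarrow> 'a \<Rightarrow> real) \<Rightarrow> ('a \<Rightarrow> real) \<Rightarrow> ennreal" where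
  "risk X g n fhat f =
    (\<integral>\<^sup>+ \<omega>. (\<integral>\<^sup>+ x. ennreal ((fhat (observations n f \<omega>) x - f x)\<^sup>2 * g x) \<partial>restrict_space lborel X)
       \<partial>design_noise_law X g n)"

definition lower_minimax_rate ::
    "'a::euclidean_space set \<Rightarrow> ('a \<Rightarrow> real) \<Rightarrow> ('a \<Rightarrow> real) set \<Rightarrow> (nat \<Rightarrow> real) \<Rightarrow> bool" where
  "lower_minimax_rate X g F a \<longleftrightarrow>
    0 < liminf (\<lambda>n. INF fhat\<in>estimators X n. SUP f\<in>F. risk X g n fhat f / ennreal (a n))"

end

theory Submission imports Defs begin

text \<open>
  The proof is Assouad's method. A small ball in the open set \<open>X\<close> contains about \<open>r\<close> to the power
  \<open>- d\<close> disjoint balls of radius \<open>r\<close> (\<open>open_set_packing\<close>). On each of them a tent of height \<open>B\<close> is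
  either present or absent, which gives one regression function \<open>f\<^sub>S\<close> for each set \<open>S\<close> of centres.

  All these functions lie between \<open>0\<close> and \<open>B\<close> and have the Lipschitz constant \<open>B / r\<close>. This alone
  bounds the square of the Sobolev norm by a constant times \<open>B\<^sup>2 r powr (- 2 s)\<close> (\<open>gagliardo_sq_le\<close>,
  \<open>tents_in_sobolev_ball\<close>), so the height may be taken of order \<open>M r powr s\<close>.

  Two functions that differ by one tent have squared \<open>L\<^sup>2\<close> distance of order \<open>B\<^sup>2 r ^ d\<close>. If \<open>n\<close> times
  this quantity is bounded by a suitable constant, the laws of the two samples overlap by at least
  \<open>1 / 8\<close> (\<open>nn_integral_min_likelihood\<close>). Every estimator then errs by a multiple of \<open>B\<^sup>2 r ^ d\<close> on
  the support of that tent, for at least one of the two functions (\<open>two_point_lower_bound\<close>). As the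
  supports are disjoint, these errors add up when one averages over all \<open>S\<close> (\<open>assouad_pairing\<close>,
  \<open>risk_lower_bound\<close>), and some \<open>f\<^sub>S\<close> has a risk of order \<open>B\<^sup>2\<close>.

  The condition on \<open>n\<close> reads \<open>n M\<^sup>2 r powr (2 s + d) = const\<close>; solving it for \<open>r\<close> turns
  \<open>B\<^sup>2 = const M\<^sup>2 r powr (2 s)\<close> into the stated rate, with the stated power of \<open>M\<close>
  (\<open>minimax_lower_bound\<close>).
\<close>

section \<open>Changing the regression function as a change of density\<close>

abbreviation std_normal :: "real measure" where
  "std_normal \<equiv> density lborel (\<lambda>t. ennreal (std_normal_density t))"

text \<open>
  This is the density at \<open>y\<close> of \<open>N(a, 1)\<close> with respect to \<open>N(0, 1)\<close>. Densities are taken with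
  respect to the law of the sample under the zero regression function, so that all hypotheses live
  on one probability space.
\<close>
definition gauss_lr :: "real \<Rightarrow> real \<Rightarrow> real" where
  "gauss_lr a y = exp (a * y - a\<^sup>2 / 2)"

definition likelihood :: "('a \<Rightarrow> real) \<Rightarrow> nat \<Rightarrow> (nat \<Rightarrow> 'a \<times> real) \<Rightarrow> real" where
  "likelihood f n \<omega> = (\<Prod>i<n. gauss_lr (f (fst (\<omega> i))) (snd (\<omega> i)))"

abbreviation sample_law :: "'a measure \<Rightarrow> nat \<Rightarrow> (nat \<Rightarrow> 'a \<times> real) measure" where
  "sample_law \<mu> n \<equiv> \<Pi>\<^sub>M i\<in>{..<n}. \<mu> \<Otimes>\<^sub>M std_normal"

lemma gauss_lr_measurable [measurable]:
  "(\<lambda>p. gauss_lr (f p) (h p)) \<in> borel_measurable M"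
  if [measurable]: "f \<in> borel_measurable M" "h \<in> borel_measurable M"
  unfolding gauss_lr_def by measurable

lemma prob_space_std_normal: "prob_space std_normal"
  by (rule prob_space_normal_density) simp

lemma nn_integral_std_normal_shift:
  assumes [measurable]: "H \<in> borel_measurable borel"
  shows "(\<integral>\<^sup>+t. H (a + t) \<partial>std_normal) = (\<integral>\<^sup>+y. H y * ennreal (gauss_lr a y) \<partial>std_normal)"
proof -
  have density_shift: "std_normal_density (y - a) = std_normal_density y * gauss_lr a y" for y
  proof -
    have "- (y - a)\<^sup>2 / 2 = - y\<^sup>2 / 2 + (a * y - a\<^sup>2 / 2)"
      by (simp add: power2_eq_square field_simps)
    then show ?thesis
      unfolding std_normal_density_def gauss_lr_def by (simp only: exp_add mult.assoc)
  qed
  have "(\<integral>\<^sup>+t. H (a + t) \<partial>std_normal) = (\<integral>\<^sup>+t. ennreal (std_normal_density t) * H (a + t) \<partial>lborel)"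
    by (simp add: nn_integral_density)
  also have "\<dots> = (\<integral>\<^sup>+y. ennreal (std_normal_density (y - a)) * H y \<partial>lborel)"
    by (subst (2) nn_integral_real_affine[where c=1 and t=a]) simp_all
  also have "\<dots> = (\<integral>\<^sup>+y. ennreal (std_normal_density y) * (H y * ennreal (gauss_lr a y)) \<partial>lborel)"
    unfolding density_shift
    by (intro nn_integral_cong) (simp add: ennreal_mult' gauss_lr_def mult_ac)
  also have "\<dots> = (\<integral>\<^sup>+y. H y * ennreal (gauss_lr a y) \<partial>std_normal)"
    by (simp add: nn_integral_density)
  finally show ?thesis .
qed

lemma nn_integral_gauss_lr: "(\<integral>\<^sup>+y. ennreal (gauss_lr a y) \<partial>std_normal) = 1"
  using nn_integral_std_normal_shift[of "\<lambda>_. 1" a] prob_space.emeasure_space_1[OF prob_space_std_normal]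
  by simp

text \<open>
  Completing the square: the geometric mean of the two densities is, up to the factor
  \<open>exp (- (a - b)\<^sup>2 / 8)\<close>, the density of the normal law centred at the midpoint \<open>(a + b) / 2\<close>.
\<close>
lemma nn_integral_sqrt_gauss_lr:
  "(\<integral>\<^sup>+y. ennreal (sqrt (gauss_lr a y * gauss_lr b y)) \<partial>std_normal) = ennreal (exp (- (a - b)\<^sup>2 / 8))"
proof -
  have *: "sqrt (gauss_lr a y * gauss_lr b y) = exp (- (a - b)\<^sup>2 / 8) * gauss_lr ((a + b) / 2) y" for y
  proof -
    have "gauss_lr a y * gauss_lr b y = (exp (- (a - b)\<^sup>2 / 8) * gauss_lr ((a + b) / 2) y)\<^sup>2"
      unfolding gauss_lr_def power2_eq_square mult_exp_exp
      by (rule arg_cong[where f=exp]) (simp add: field_simps)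
    then show ?thesis by (simp add: gauss_lr_def)
  qed
  show ?thesis
    unfolding * by (simp add: ennreal_mult' nn_integral_cmult nn_integral_gauss_lr)
qed

lemma prob_space_sample_law:
  assumes "prob_space \<mu>"
  shows "prob_space (sample_law \<mu> n)"
proof -
  interpret \<mu>: prob_space \<mu> by fact
  interpret N: prob_space std_normal by (rule prob_space_std_normal)
  interpret P: pair_prob_space \<mu> std_normal ..
  show ?thesis by (rule prob_space_PiM) (rule P.prob_space_axioms)
qed

text \<open>
  Given the design point, adding \<open>f\<close> translates the normal noise, so Tonelli reduces this to the
  one-dimensional shift.
\<close>
lemma distr_regression_step:
  assumes f [measurable]: "f \<in> borel_measurable \<mu>"
  shows "distr (\<mu> \<Otimes>\<^sub>M std_normal) (\<mu> \<Otimes>\<^sub>M std_normal) (\<lambda>p. (fst p, f (fst p) + snd p)) =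
    density (\<mu> \<Otimes>\<^sub>M std_normal) (\<lambda>p. ennreal (gauss_lr (f (fst p)) (snd p)))" (is "?L = ?R")
proof (rule measure_eqI)
  interpret N: prob_space std_normal by (rule prob_space_std_normal)
  fix A assume "A \<in> sets ?L"
  then have A [measurable]: "A \<in> sets (\<mu> \<Otimes>\<^sub>M std_normal)" by simp
  have "emeasure ?L A = (\<integral>\<^sup>+p. indicator A (fst p, f (fst p) + snd p) \<partial>(\<mu> \<Otimes>\<^sub>M std_normal))"
    by (subst nn_integral_indicator[OF \<open>A \<in> sets ?L\<close>, symmetric], subst nn_integral_distr) simp_all
  also have "\<dots> = (\<integral>\<^sup>+x. \<integral>\<^sup>+t. indicator A (x, f x + t) \<partial>std_normal \<partial>\<mu>)"
    by (subst N.nn_integral_fst[symmetric]) simp_all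
  also have "\<dots> = (\<integral>\<^sup>+x. \<integral>\<^sup>+y. indicator A (x, y) * ennreal (gauss_lr (f x) y) \<partial>std_normal \<partial>\<mu>)"
  proof (rule nn_integral_cong)
    fix x assume x: "x \<in> space \<mu>"
    have "(\<lambda>y. indicator A (x, y) :: ennreal) \<in> borel_measurable std_normal"
      using x by measurable
    then show "(\<integral>\<^sup>+t. indicator A (x, f x + t) \<partial>std_normal) =
        (\<integral>\<^sup>+y. indicator A (x, y) * ennreal (gauss_lr (f x) y) \<partial>std_normal)"
      by (intro nn_integral_std_normal_shift) simp
  qed
  also have "\<dots> = (\<integral>\<^sup>+p. indicator A p * ennreal (gauss_lr (f (fst p)) (snd p)) \<partial>(\<mu> \<Otimes>\<^sub>M std_normal))"
    by (subst N.nn_integral_fst[symmetric]) simp_all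
  also have "\<dots> = emeasure ?R A"
    by (subst emeasure_density) (use A in \<open>simp_all add: mult.commute\<close>)
  finally show "emeasure ?L A = emeasure ?R A" .
qed simp

lemma likelihood_measurable [measurable]:
  assumes [measurable]: "f \<in> borel_measurable \<mu>"
  shows "likelihood f n \<in> borel_measurable (sample_law \<mu> n)"
  unfolding likelihood_def by measurable

lemma likelihood_nonneg: "0 \<le> likelihood f n \<omega>"
  by (simp add: likelihood_def gauss_lr_def prod_nonneg)

lemma observations_eq_compose:
  "observations n f = compose {..<n} (\<lambda>p. (fst p, f (fst p) + snd p))"
  by (simp add: observations_def compose_def fun_eq_iff)

lemma observations_measurable [measurable]:
  assumes [measurable]: "f \<in> borel_measurable \<mu>"
  shows "observations n f \<in> sample_law \<mu> n \<rightarrow>\<^sub>M sample_law \<mu> n"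
  unfolding observations_def by measurable

text \<open>
  Both sides are product measures, so it suffices to compare them coordinate by coordinate; each
  coordinate is one step of the regression.
\<close>
lemma distr_observations:
  assumes \<mu>: "prob_space \<mu>" and f [measurable]: "f \<in> borel_measurable \<mu>"
  shows "distr (sample_law \<mu> n) (sample_law \<mu> n) (observations n f) =
    density (sample_law \<mu> n) (\<lambda>\<omega>. ennreal (likelihood f n \<omega>))"
proof -
  let ?N = "\<mu> \<Otimes>\<^sub>M std_normal" and ?T = "\<lambda>p. (fst p, f (fst p) + snd p)"
  interpret \<mu>: prob_space \<mu> by fact
  interpret N: prob_space std_normal by (rule prob_space_std_normal)
  interpret pair_prob_space \<mu> std_normal ..
  interpret P: product_prob_space "\<lambda>_::nat. ?N" ..
  let ?D = "density ?N (\<lambda>p. ennreal (gauss_lr (f (fst p)) (snd p)))"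
  have D: "distr ?N ?N ?T = ?D" by (rule distr_regression_step) fact
  have "prob_space (distr ?N ?N ?T)" by (rule prob_space_distr) simp
  then interpret D: prob_space ?D by (simp only: D)
  interpret PD: product_prob_space "\<lambda>_::nat. ?D" ..
  have "distr (sample_law \<mu> n) (sample_law \<mu> n) (observations n f) = (\<Pi>\<^sub>M i\<in>{..<n}. ?D)"
    unfolding observations_eq_compose D[symmetric]
    by (rule distr_PiM_finite_prob_space) (simp_all add: P.product_prob_space_axioms)
  also have "\<dots> = density (sample_law \<mu> n) (\<lambda>\<omega>. ennreal (likelihood f n \<omega>))"
  proof (rule PD.PiM_eqI[symmetric])
    show "sets (density (sample_law \<mu> n) (\<lambda>\<omega>. ennreal (likelihood f n \<omega>))) = sets (\<Pi>\<^sub>M i\<in>{..<n}. ?D)"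
      by (simp cong: sets_PiM_cong)
    fix A assume "\<And>i. i \<in> {..<n} \<Longrightarrow> A i \<in> sets ?D"
    then have A [measurable]: "\<And>i. i \<in> {..<n} \<Longrightarrow> A i \<in> sets ?N" by simp
    have box: "Pi\<^sub>E {..<n} A \<in> sets (sample_law \<mu> n)"
      using A by (intro sets_PiM_I_finite) auto
    have "emeasure (density (sample_law \<mu> n) (\<lambda>\<omega>. ennreal (likelihood f n \<omega>))) (Pi\<^sub>E {..<n} A) =
        (\<integral>\<^sup>+\<omega>. (\<Prod>i<n. ennreal (gauss_lr (f (fst (\<omega> i))) (snd (\<omega> i))) * indicator (A i) (\<omega> i)) \<partial>sample_law \<mu> n)"
      unfolding emeasure_density[OF _ box, of "\<lambda>\<omega>. ennreal (likelihood f n \<omega>)", simplified]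
    proof (rule nn_integral_cong)
      fix \<omega> assume "\<omega> \<in> space (sample_law \<mu> n)"
      then have "indicator (Pi\<^sub>E {..<n} A) \<omega> = (\<Prod>i<n. indicator (A i) (\<omega> i) :: ennreal)"
        by (auto simp: indicator_def space_PiM PiE_iff)
      then show "ennreal (likelihood f n \<omega>) * indicator (Pi\<^sub>E {..<n} A) \<omega> =
        (\<Prod>i<n. ennreal (gauss_lr (f (fst (\<omega> i))) (snd (\<omega> i))) * indicator (A i) (\<omega> i))"
        by (simp add: likelihood_def prod.distrib prod_ennreal gauss_lr_def)
    qed
    also have "\<dots> = (\<Prod>i<n. \<integral>\<^sup>+p. ennreal (gauss_lr (f (fst p)) (snd p)) * indicator (A i) p \<partial>?N)"
      by (rule P.product_nn_integral_prod) simp_all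
    also have "\<dots> = (\<Prod>i<n. emeasure ?D (A i))"
      by (intro prod.cong refl, subst emeasure_density) (use A in auto)
    finally show "emeasure (density (sample_law \<mu> n) (\<lambda>\<omega>. ennreal (likelihood f n \<omega>))) (Pi\<^sub>E {..<n} A) =
      (\<Prod>i\<in>{..<n}. emeasure ?D (A i))" .
  qed simp
  finally show ?thesis .
qed

text \<open>
  This is how the likelihood enters: every expectation of a function of the sample becomes an
  integral against one measure that is independent of the regression function.
\<close>
lemma nn_integral_observations:
  assumes "prob_space \<mu>" and [measurable]: "f \<in> borel_measurable \<mu>" "G \<in> borel_measurable (sample_law \<mu> n)"
  shows "(\<integral>\<^sup>+\<omega>. G (observations n f \<omega>) \<partial>sample_law \<mu> n) =
    (\<integral>\<^sup>+\<omega>. ennreal (likelihood f n \<omega>) * G \<omega> \<partial>sample_law \<mu> n)"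
proof -
  have "(\<integral>\<^sup>+\<omega>. G (observations n f \<omega>) \<partial>sample_law \<mu> n) =
      (\<integral>\<^sup>+\<omega>. G \<omega> \<partial>distr (sample_law \<mu> n) (sample_law \<mu> n) (observations n f))"
    by (simp add: nn_integral_distr)
  also have "\<dots> = (\<integral>\<^sup>+\<omega>. ennreal (likelihood f n \<omega>) * G \<omega> \<partial>sample_law \<mu> n)"
    using assms by (simp add: distr_observations nn_integral_density)
  finally show ?thesis .
qed

lemma nn_integral_likelihood:
  assumes "prob_space \<mu>" and [measurable]: "f \<in> borel_measurable \<mu>"
  shows "(\<integral>\<^sup>+\<omega>. ennreal (likelihood f n \<omega>) \<partial>sample_law \<mu> n) = 1"
  using nn_integral_observations[OF assms, of "\<lambda>_. 1" n]
    prob_space.emeasure_space_1[OF prob_space_sample_law[OF assms(1), of n]]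
  by simp

section \<open>Two hypotheses\<close>

text \<open>
  The Hellinger affinity of two samples is multiplicative over the \<open>n\<close> observations, and one
  observation contributes the mean of \<open>exp (- (f - f')\<^sup>2 / 8) \<ge> 1 - (f - f')\<^sup>2 / 8\<close>. Bernoulli's
  inequality then bounds the product below by \<open>1 - n v / 8\<close>.
\<close>
lemma hellinger_affinity_likelihood:
  assumes \<mu>: "prob_space \<mu>" and [measurable]: "f \<in> borel_measurable \<mu>" "f' \<in> borel_measurable \<mu>"
    and v: "(\<integral>\<^sup>+x. ennreal ((f x - f' x)\<^sup>2) \<partial>\<mu>) \<le> ennreal v" "real n * v \<le> 4"
  shows "(\<integral>\<^sup>+\<omega>. ennreal (sqrt (likelihood f n \<omega> * likelihood f' n \<omega>)) \<partial>sample_law \<mu> n) \<ge> ennreal (1 / 2)"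
proof -
  interpret \<mu>: prob_space \<mu> by fact
  interpret N: prob_space std_normal by (rule prob_space_std_normal)
  interpret pair_prob_space \<mu> std_normal ..
  interpret P: product_prob_space "\<lambda>_::nat. \<mu> \<Otimes>\<^sub>M std_normal" ..
  show ?thesis
  proof (cases "n = 0")
    \<comment> \<open>without observations \<open>v\<close> may be arbitrarily large, but the affinity is \<open>1\<close>\<close>
    case True
    have "ennreal (1 / 2) \<le> ennreal 1" by (rule ennreal_leI) simp
    with True show ?thesis
      using prob_space.emeasure_space_1[OF prob_space_sample_law[OF \<mu>, of 0]]
      by (simp add: likelihood_def)
  next
    case False
    \<comment> \<open>for negative \<open>v\<close> the first hypothesis holds exactly if the integral is \<open>0\<close>, as for \<open>v = 0\<close>\<close>
    define w where "w = max v 0"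
    have w: "0 \<le> w" "real n * w \<le> 4" using v(2) by (auto simp: w_def max_def)
    have w_le: "w \<le> 4"
    proof -
      have "1 * w \<le> real n * w" using False w(1) by (intro mult_right_mono) auto
      with w(2) show ?thesis by simp
    qed
    define \<rho> where "\<rho> = (\<integral>\<^sup>+x. ennreal (exp (- (f x - f' x)\<^sup>2 / 8)) \<partial>\<mu>)"
    have "1 = (\<integral>\<^sup>+x. 1 \<partial>\<mu>)" by (simp add: \<mu>.emeasure_space_1)
    also have "\<dots> \<le> (\<integral>\<^sup>+x. ennreal (exp (- (f x - f' x)\<^sup>2 / 8)) + ennreal (1 / 8) * ennreal ((f x - f' x)\<^sup>2) \<partial>\<mu>)"
    proof (rule nn_integral_mono)
      fix x
      have "1 \<le> exp (- (f x - f' x)\<^sup>2 / 8) + 1 / 8 * (f x - f' x)\<^sup>2"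
        using exp_ge_add_one_self[of "- (f x - f' x)\<^sup>2 / 8"] by simp
      then show "1 \<le> ennreal (exp (- (f x - f' x)\<^sup>2 / 8)) + ennreal (1 / 8) * ennreal ((f x - f' x)\<^sup>2)"
        by (simp add: ennreal_mult'[symmetric] ennreal_plus[symmetric] ennreal_1[symmetric] ennreal_leI
            del: ennreal_plus ennreal_1)
    qed
    also have "\<dots> = \<rho> + ennreal (1 / 8) * (\<integral>\<^sup>+x. ennreal ((f x - f' x)\<^sup>2) \<partial>\<mu>)"
      by (simp add: \<rho>_def nn_integral_add nn_integral_cmult)
    also have "\<dots> \<le> \<rho> + ennreal (1 / 8) * ennreal w"
      using v(1) by (intro add_left_mono mult_left_mono order_trans[OF v(1)]) (auto simp: w_def ennreal_leI)
    also have "\<dots> = \<rho> + ennreal (w / 8)"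
      using w(1) by (simp add: ennreal_mult'[symmetric])
    finally have "ennreal (1 - w / 8) \<le> \<rho>"
      using w(1) by (simp add: ennreal_minus[symmetric] ennreal_minus_le_iff add.commute)
    then have pow: "ennreal (1 - w / 8) ^ n \<le> \<rho> ^ n" by (rule power_mono) simp
    have "1 / 2 \<le> 1 + real n * (- (w / 8))" using w(2) by (simp add: mult.commute)
    also have "\<dots> \<le> (1 + - (w / 8)) ^ n"
      using w_le by (intro Bernoulli_inequality) simp
    finally have "1 / 2 \<le> (1 - w / 8) ^ n" by simp
    then have "ennreal (1 / 2) \<le> ennreal ((1 - w / 8) ^ n)"
      by (rule ennreal_leI)
    also have "\<dots> = ennreal (1 - w / 8) ^ n"
      using w_le by (simp add: ennreal_power)
    also note pow
    also have "\<rho> = (\<integral>\<^sup>+p. ennreal (sqrt (gauss_lr (f (fst p)) (snd p) * gauss_lr (f' (fst p)) (snd p)))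
        \<partial>(\<mu> \<Otimes>\<^sub>M std_normal))"
      unfolding \<rho>_def nn_integral_sqrt_gauss_lr[symmetric] by (subst N.nn_integral_fst[symmetric]) simp_all
    also have "\<dots> ^ n = (\<integral>\<^sup>+\<omega>. (\<Prod>i<n. ennreal (sqrt (gauss_lr (f (fst (\<omega> i))) (snd (\<omega> i)) *
        gauss_lr (f' (fst (\<omega> i))) (snd (\<omega> i))))) \<partial>sample_law \<mu> n)"
      by (subst P.product_nn_integral_prod) simp_all
    also have "\<dots> = (\<integral>\<^sup>+\<omega>. ennreal (sqrt (likelihood f n \<omega> * likelihood f' n \<omega>)) \<partial>sample_law \<mu> n)"
    proof -
      have "sqrt (\<Prod>i<n. g i) = (\<Prod>i<n. sqrt (g i))" for g :: "nat \<Rightarrow> real"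
        by (induction n) (simp_all add: real_sqrt_mult)
      then show ?thesis
        by (simp add: likelihood_def prod_ennreal gauss_lr_def flip: prod.distrib)
    qed
    finally show ?thesis .
  qed
qed

text \<open>
  Expand \<open>(sqrt (min a b) - sqrt (max a b) / 4)\<^sup>2 \<ge> 0\<close> and use \<open>max a b \<le> a + b\<close>. Integrated over two
  probability densities, it bounds their overlap below by their Hellinger affinity, in place of the
  Cauchy-Schwarz inequality.
\<close>
lemma sqrt_le_min_plus:
  fixes a b :: real
  assumes "0 \<le> a" "0 \<le> b"
  shows "sqrt (a * b) / 2 \<le> min a b + (a + b) / 16"
proof -
  have *: "sqrt (a * b) / 2 \<le> a + (a + b) / 16" if "0 \<le> a" "a \<le> b" for a b :: real
  proof -
    have "sqrt a * sqrt b / 2 \<le> a + b / 16"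
      using sum_squares_ge_zero[of "sqrt a - sqrt b / 4" 0] that
      by (simp add: power2_eq_square[symmetric] power2_diff power_divide)
    moreover have "0 \<le> a / 16" using that by simp
    ultimately show ?thesis unfolding real_sqrt_mult add_divide_distrib by linarith
  qed
  show ?thesis
    using *[of a b] *[of b a] assms by (cases "a \<le> b") (auto simp: min_def mult.commute add.commute)
qed

lemma nn_integral_min_likelihood:
  assumes \<mu>: "prob_space \<mu>" and [measurable]: "f \<in> borel_measurable \<mu>" "f' \<in> borel_measurable \<mu>"
    and v: "(\<integral>\<^sup>+x. ennreal ((f x - f' x)\<^sup>2) \<partial>\<mu>) \<le> ennreal v" "real n * v \<le> 4"
  shows "(\<integral>\<^sup>+\<omega>. ennreal (min (likelihood f n \<omega>) (likelihood f' n \<omega>)) \<partial>sample_law \<mu> n) \<ge> ennreal (1 / 8)"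
    (is "?m \<ge> _")
proof -
  let ?L = "likelihood f n" and ?L' = "likelihood f' n"
  have "ennreal (1 / 4) = ennreal (1 / 2) * ennreal (1 / 2)"
    by (subst ennreal_mult'[symmetric]) simp_all
  also have "\<dots> \<le> ennreal (1 / 2) * (\<integral>\<^sup>+\<omega>. ennreal (sqrt (?L \<omega> * ?L' \<omega>)) \<partial>sample_law \<mu> n)"
    by (intro mult_left_mono hellinger_affinity_likelihood[OF assms]) simp
  also have "\<dots> = (\<integral>\<^sup>+\<omega>. ennreal (1 / 2) * ennreal (sqrt (?L \<omega> * ?L' \<omega>)) \<partial>sample_law \<mu> n)"
    by (simp add: nn_integral_cmult)
  also have "\<dots> \<le> (\<integral>\<^sup>+\<omega>. ennreal (min (?L \<omega>) (?L' \<omega>)) +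
      ennreal (1 / 16) * (ennreal (?L \<omega>) + ennreal (?L' \<omega>)) \<partial>sample_law \<mu> n)"
  proof (rule nn_integral_mono)
    fix \<omega>
    have "1 / 2 * sqrt (?L \<omega> * ?L' \<omega>) \<le> min (?L \<omega>) (?L' \<omega>) + 1 / 16 * (?L \<omega> + ?L' \<omega>)"
      using sqrt_le_min_plus[of "?L \<omega>" "?L' \<omega>"] by (simp add: likelihood_nonneg)
    then have "ennreal (1 / 2 * sqrt (?L \<omega> * ?L' \<omega>)) \<le>
        ennreal (min (?L \<omega>) (?L' \<omega>) + 1 / 16 * (?L \<omega> + ?L' \<omega>))"
      by (rule ennreal_leI)
    then show "ennreal (1 / 2) * ennreal (sqrt (?L \<omega> * ?L' \<omega>)) \<le> ennreal (min (?L \<omega>) (?L' \<omega>)) +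
      ennreal (1 / 16) * (ennreal (?L \<omega>) + ennreal (?L' \<omega>))"
      by (subst ennreal_mult'[symmetric], simp)
        (simp add: ennreal_mult'[symmetric] ennreal_plus[symmetric] likelihood_nonneg del: ennreal_plus)
  qed
  also have "\<dots> = ?m + ennreal (1 / 16) * (1 + 1)"
    by (simp add: nn_integral_add nn_integral_cmult nn_integral_likelihood[OF \<mu>])
  also have "ennreal (1 / 16) * (1 + 1) = ennreal (1 / 8)"
  proof -
    have "(1 + 1 :: ennreal) = ennreal 2" by simp
    then show ?thesis by (simp only:, subst ennreal_mult'[symmetric]) simp_all
  qed
  finally have "ennreal (1 / 4) - ennreal (1 / 8) \<le> ?m"
    by (simp add: ennreal_minus_le_iff add.commute)
  then show ?thesis by (simp add: ennreal_minus)
qed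

text \<open>
  Le Cam's argument. At each sample the losses \<open>G\<close> and \<open>G'\<close> under the two hypotheses add up to at least
  \<open>\<delta>\<close>, and the two laws of the sample share at least the mass \<open>1 / 8\<close>: on this common part the
  estimator pays for both losses at once.
\<close>
lemma two_point_lower_bound:
  assumes \<mu>: "prob_space \<mu>" and [measurable]: "f \<in> borel_measurable \<mu>" "f' \<in> borel_measurable \<mu>"
    and v: "(\<integral>\<^sup>+x. ennreal ((f x - f' x)\<^sup>2) \<partial>\<mu>) \<le> ennreal v" "real n * v \<le> 4"
    and [measurable]: "G \<in> borel_measurable (sample_law \<mu> n)" "G' \<in> borel_measurable (sample_law \<mu> n)"
    and sep: "\<And>\<omega>. \<omega> \<in> space (sample_law \<mu> n) \<Longrightarrow> \<delta> \<le> G \<omega> + G' \<omega>"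
  shows "\<delta> * ennreal (1 / 8) \<le> (\<integral>\<^sup>+\<omega>. G (observations n f \<omega>) \<partial>sample_law \<mu> n) +
    (\<integral>\<^sup>+\<omega>. G' (observations n f' \<omega>) \<partial>sample_law \<mu> n)"
proof -
  let ?L = "likelihood f n" and ?L' = "likelihood f' n"
  have "\<delta> * ennreal (1 / 8) \<le> \<delta> * (\<integral>\<^sup>+\<omega>. ennreal (min (?L \<omega>) (?L' \<omega>)) \<partial>sample_law \<mu> n)"
    by (intro mult_left_mono nn_integral_min_likelihood[OF \<mu> _ _ v]) simp_all
  also have "\<dots> = (\<integral>\<^sup>+\<omega>. \<delta> * ennreal (min (?L \<omega>) (?L' \<omega>)) \<partial>sample_law \<mu> n)"
    by (simp add: nn_integral_cmult)
  also have "\<dots> \<le> (\<integral>\<^sup>+\<omega>. ennreal (?L \<omega>) * G \<omega> + ennreal (?L' \<omega>) * G' \<omega> \<partial>sample_law \<mu> n)"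
  proof (rule nn_integral_mono)
    fix \<omega> assume "\<omega> \<in> space (sample_law \<mu> n)"
    then have "\<delta> * ennreal (min (?L \<omega>) (?L' \<omega>)) \<le> (G \<omega> + G' \<omega>) * ennreal (min (?L \<omega>) (?L' \<omega>))"
      by (intro mult_right_mono sep) simp_all
    also have "\<dots> = ennreal (min (?L \<omega>) (?L' \<omega>)) * G \<omega> + ennreal (min (?L \<omega>) (?L' \<omega>)) * G' \<omega>"
      by (simp add: distrib_right mult.commute)
    also have "\<dots> \<le> ennreal (?L \<omega>) * G \<omega> + ennreal (?L' \<omega>) * G' \<omega>"
      by (intro add_mono mult_right_mono ennreal_leI) simp_all
    finally show "\<delta> * ennreal (min (?L \<omega>) (?L' \<omega>)) \<le> ennreal (?L \<omega>) * G \<omega> + ennreal (?L' \<omega>) * G' \<omega>" .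
  qed
  also have "\<dots> = (\<integral>\<^sup>+\<omega>. G (observations n f \<omega>) \<partial>sample_law \<mu> n) +
    (\<integral>\<^sup>+\<omega>. G' (observations n f' \<omega>) \<partial>sample_law \<mu> n)"
    by (simp add: nn_integral_add nn_integral_observations[OF \<mu>])
  finally show ?thesis .
qed

section \<open>Reduction to two hypotheses per cell\<close>

text \<open>
  Averaging over all \<open>S \<subseteq> K\<close>: for fixed \<open>k\<close>, flipping the membership of \<open>k\<close> permutes the subsets, so
  the average of the \<open>k\<close>-th share of the risk is the average of half the sum over a flipped pair.
  Some \<open>S\<close> does at least as badly as the average.
\<close>
lemma assouad_pairing:
  fixes R :: "'k set \<Rightarrow> ennreal" and r :: "'k \<Rightarrow> 'k set \<Rightarrow> ennreal"
  assumes K: "finite K"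
    and split: "\<And>S. S \<subseteq> K \<Longrightarrow> (\<Sum>k\<in>K. r k S) \<le> R S"
    and pair: "\<And>k S. k \<in> K \<Longrightarrow> S \<subseteq> K \<Longrightarrow> c \<le> r k S + r k (sym_diff S {k})"
  shows "\<exists>S\<subseteq>K. of_nat (card K) * (c / 2) \<le> R S"
proof -
  have cell: "of_nat (card (Pow K)) * (c / 2) \<le> (\<Sum>S\<in>Pow K. r k S)" if k: "k \<in> K" for k
  proof -
    \<comment> \<open>flipping membership of a point of \<open>K\<close> is an involution of the power set\<close>
    have flip: "(\<Sum>S\<in>Pow K. r k (sym_diff S {k})) = (\<Sum>S\<in>Pow K. r k S)"
      using k by (intro sum.reindex_bij_witness[where i="\<lambda>S. sym_diff S {k}" and j="\<lambda>S. sym_diff S {k}"]) auto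
    have "of_nat (card (Pow K)) * c \<le> (\<Sum>S\<in>Pow K. r k S + r k (sym_diff S {k}))"
      using sum_mono[of "Pow K" "\<lambda>_. c"] pair[OF k] by simp
    also have "\<dots> = 2 * (\<Sum>S\<in>Pow K. r k S)"
      by (simp add: sum.distrib flip mult_2)
    finally have "of_nat (card (Pow K)) * c / 2 \<le> (2 * (\<Sum>S\<in>Pow K. r k S)) / 2"
      by (rule divide_right_mono_ennreal)
    then show ?thesis
      by (simp add: ennreal_times_divide mult.commute[of 2] ennreal_mult_divide_eq)
  qed
  have "Max (R ` Pow K) \<in> R ` Pow K" using K by (intro Max_in) auto
  then obtain S where S: "S \<in> Pow K" "\<forall>T\<in>Pow K. R T \<le> R S"
    using K by (metis Max_ge finite_Pow_iff finite_imageI image_iff)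
  have "of_nat (card (Pow K)) * (of_nat (card K) * (c / 2)) =
      (\<Sum>k\<in>K. of_nat (card (Pow K)) * (c / 2))"
    by (simp add: mult_ac)
  also have "\<dots> \<le> (\<Sum>k\<in>K. \<Sum>T\<in>Pow K. r k T)" by (intro sum_mono cell)
  also have "\<dots> = (\<Sum>T\<in>Pow K. \<Sum>k\<in>K. r k T)" by (rule sum.swap)
  also have "\<dots> \<le> (\<Sum>T\<in>Pow K. R S)"
    using S split by (intro sum_mono) (meson order_trans Pow_iff)
  also have "\<dots> = of_nat (card (Pow K)) * R S" by simp
  finally have "of_nat (card K) * (c / 2) \<le> R S"
    using K by (subst (asm) ennreal_mult_le_mult_iff) (simp_all add: ennreal_of_nat_eq_real_of_nat Pow_not_empty)
  with S show ?thesis by auto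
qed

section \<open>The Gagliardo seminorm of Lipschitz functions at a given scale\<close>

text \<open>
  The best bound on the Gagliardo integrand, in terms of the increment \<open>z = x - y\<close>, for a function with
  oscillation at most \<open>1\<close> and Lipschitz constant \<open>1\<close>.
\<close>
definition scale_kernel :: "real \<Rightarrow> 'a::euclidean_space \<Rightarrow> real" where
  "scale_kernel s z = min ((norm z)\<^sup>2) 1 / norm z powr (real DIM('a) + 2 * s)"

definition kernel_mass :: "'a::euclidean_space itself \<Rightarrow> real \<Rightarrow> ennreal" where
  "kernel_mass _ s = (\<integral>\<^sup>+z. ennreal (scale_kernel s (z::'a)) \<partial>lborel)"

lemma scale_kernel_measurable [measurable]: "scale_kernel s \<in> borel_measurable borel"
  unfolding scale_kernel_def by measurable

lemma dyadic_bracket: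
  fixes t :: real
  assumes "1 \<le> t"
  shows "\<exists>j. 2 ^ j \<le> t \<and> t \<le> 2 * 2 ^ j"
proof -
  have ex: "\<exists>n. t < 2 ^ n" by (rule real_arch_pow) simp
  define m where "m = (LEAST n. t < 2 ^ n)"
  have m: "t < 2 ^ m" unfolding m_def using ex by (rule LeastI_ex)
  then obtain j where j: "m = Suc j" using assms by (cases m) auto
  have "\<not> t < 2 ^ j" using j not_less_Least[of j "\<lambda>n. t < 2 ^ n"] by (simp add: m_def)
  with m j show ?thesis by (intro exI[of _ j]) auto
qed

text \<open>
  Near the origin the kernel is \<open>norm z\<close> to the power \<open>2 - d - 2s\<close>, integrable because \<open>s < 1\<close>; at
  infinity it is \<open>norm z\<close> to the power \<open>- d - 2s\<close>, integrable because \<open>s > 0\<close>. Cutting the space into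
  dyadic annuli bounds the integral by two geometric series, of ratios \<open>2 powr (2 s - 2)\<close> and
  \<open>2 powr (- 2 s)\<close>.
\<close>
lemma kernel_mass_finite:
  assumes "0 < s" "s < 1"
  shows "kernel_mass TYPE('a::euclidean_space) s < \<infinity>"
proof -
  define d where "d = DIM('a)"
  define p where "p = real d + 2 * s"
  have p: "0 < p" using assms by (simp add: p_def)
  define a where "a j = (1 / 2 ^ j)\<^sup>2 * (2 * 2 ^ j) powr p" for j :: nat
  define b where "b j = 1 / (2 ^ j) powr p" for j :: nat
  define \<omega> where "\<omega> = unit_ball_vol (real d)"
  let ?A = "\<lambda>j::nat. cball 0 (1 / 2 ^ j) :: 'a set" and ?B = "\<lambda>j::nat. cball 0 (2 * 2 ^ j) :: 'a set"
  have pow2: "(2::real) ^ j = 2 powr j" for j :: nat by (simp add: powr_realpow)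
  have term_le: "u j \<le> (\<Sum>j. u j)" for u :: "nat \<Rightarrow> ennreal" and j
    using sum_le_suminf[of u "{j}"] by simp
  have "ennreal (scale_kernel s z) \<le>
      (\<Sum>j. ennreal (a j) * indicator (?A j) z) + (\<Sum>j. ennreal (b j) * indicator (?B j) z)" for z :: 'a
  proof -
    consider "z = 0" | "0 < norm z" "norm z < 1" | "1 \<le> norm z" by force
    then show ?thesis
    proof cases
      case 1
      then show ?thesis by (simp add: scale_kernel_def)
    next
      case 2
      then have "1 \<le> 1 / norm z" by simp
      from dyadic_bracket[OF this] obtain j where j: "2 ^ j \<le> 1 / norm z" "1 / norm z \<le> 2 * 2 ^ j"
        by blast
      have z: "norm z \<le> 1 / 2 ^ j" "1 / (2 * 2 ^ j) \<le> norm z"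
        using j 2(1) by (auto simp: field_simps)
      have "scale_kernel s z \<le> (norm z)\<^sup>2 / norm z powr p"
        by (simp add: scale_kernel_def p_def d_def divide_right_mono)
      also have "\<dots> \<le> (1 / 2 ^ j)\<^sup>2 / (1 / (2 * 2 ^ j)) powr p"
        using z p by (intro frac_le power_mono powr_mono2) simp_all
      also have "\<dots> = a j" by (simp add: a_def powr_divide)
      finally have "ennreal (scale_kernel s z) \<le> ennreal (a j) * indicator (?A j) z"
        using z by (simp add: ennreal_leI)
      also have "\<dots> \<le> (\<Sum>j. ennreal (a j) * indicator (?A j) z)"
        by (rule term_le)
      finally show ?thesis by (rule order_trans) simp
    next
      case 3
      from dyadic_bracket[OF this] obtain j where j: "2 ^ j \<le> norm z" "norm z \<le> 2 * 2 ^ j"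
        by blast
      have "scale_kernel s z \<le> 1 / norm z powr p"
        by (simp add: scale_kernel_def p_def d_def divide_right_mono)
      also have "\<dots> \<le> 1 / (2 ^ j) powr p"
        using j p by (intro frac_le powr_mono2) simp_all
      also have "\<dots> = b j" by (simp add: b_def)
      finally have "ennreal (scale_kernel s z) \<le> ennreal (b j) * indicator (?B j) z"
        using j by (simp add: ennreal_leI)
      also have "\<dots> \<le> (\<Sum>j. ennreal (b j) * indicator (?B j) z)"
        by (rule term_le)
      finally show ?thesis by (rule order_trans) simp
    qed
  qed
  then have "kernel_mass TYPE('a) s \<le>
      (\<integral>\<^sup>+z. (\<Sum>j. ennreal (a j) * indicator (?A j) z) + (\<Sum>j. ennreal (b j) * indicator (?B j) z) \<partial>lborel)"
    unfolding kernel_mass_def by (rule nn_integral_mono)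
  also have "\<dots> = (\<Sum>j. ennreal (a j) * emeasure lborel (?A j)) + (\<Sum>j. ennreal (b j) * emeasure lborel (?B j))"
  proof -
    have series: "(\<integral>\<^sup>+z. (\<Sum>j. ennreal (g j) * indicator (D j) z) \<partial>lborel) =
        (\<Sum>j. ennreal (g j) * emeasure lborel (D j))"
      if [measurable]: "\<And>j. D j \<in> sets borel" for g and D :: "nat \<Rightarrow> 'a set"
      by (subst nn_integral_suminf) (simp_all add: nn_integral_cmult)
    have [measurable]: "?A j \<in> sets borel" "?B j \<in> sets borel" for j by simp_all
    show ?thesis
      by (subst nn_integral_add, measurable, simp add: series)
  qed
  also have "(\<Sum>j. ennreal (a j) * emeasure lborel (?A j)) = (\<Sum>j. ennreal (\<omega> * 2 powr p * (2 powr (2 * s - 2)) ^ j))"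
  proof (rule arg_cong[where f=suminf], rule ext)
    fix j
    have "a j * (\<omega> * (1 / 2 ^ j) ^ d) = \<omega> * 2 powr p * (2 powr (2 * s - 2)) ^ j"
      unfolding a_def p_def
      by (simp add: pow2 powr_powr powr_mult powr_divide powr_minus_divide flip: powr_realpow powr_numeral)
         (simp add: powr_add[symmetric] powr_diff[symmetric] powr_minus_divide[symmetric] field_simps)
    then show "ennreal (a j) * emeasure lborel (?A j) = ennreal (\<omega> * 2 powr p * (2 powr (2 * s - 2)) ^ j)"
      by (subst emeasure_cball) (simp_all add: \<omega>_def d_def a_def ennreal_mult'[symmetric])
  qed
  also have "(\<Sum>j. ennreal (b j) * emeasure lborel (?B j)) = (\<Sum>j. ennreal (\<omega> * 2 ^ d * (2 powr (- 2 * s)) ^ j))"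
  proof (rule arg_cong[where f=suminf], rule ext)
    fix j
    have "b j * (\<omega> * (2 * 2 ^ j) ^ d) = \<omega> * 2 ^ d * (2 powr (- 2 * s)) ^ j"
      unfolding b_def p_def
      by (simp add: pow2 powr_powr powr_mult powr_divide powr_minus_divide power_mult_distrib flip: powr_realpow powr_numeral)
         (simp add: powr_add[symmetric] powr_diff[symmetric] powr_minus_divide[symmetric] field_simps)
    then show "ennreal (b j) * emeasure lborel (?B j) = ennreal (\<omega> * 2 ^ d * (2 powr (- 2 * s)) ^ j)"
      by (subst emeasure_cball) (simp_all add: \<omega>_def d_def b_def ennreal_mult'[symmetric])
  qed
  also have "(\<Sum>j. ennreal (\<omega> * 2 powr p * (2 powr (2 * s - 2)) ^ j)) +
      (\<Sum>j. ennreal (\<omega> * 2 ^ d * (2 powr (- 2 * s)) ^ j)) < \<infinity>"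
  proof -
    have q: "2 powr (2 * s - 2) < 1" "2 powr (- 2 * s) < 1"
      using assms by (simp_all add: powr_less_one)
    have geometric: "(\<Sum>j. ennreal (a * q ^ j)) \<noteq> \<infinity>" if "0 \<le> a" "0 \<le> q" "q < 1" for a q :: real
      unfolding infinity_ennreal_def using that
      by (intro ennreal_suminf_neq_top summable_mult summable_geometric) auto
    have "(\<Sum>j. ennreal (\<omega> * 2 powr p * (2 powr (2 * s - 2)) ^ j)) \<noteq> \<infinity>"
      "(\<Sum>j. ennreal (\<omega> * 2 ^ d * (2 powr (- 2 * s)) ^ j)) \<noteq> \<infinity>"
      using q by (intro geometric; simp add: \<omega>_def)+
    then show ?thesis by (simp add: less_top)
  qed
  finally show ?thesis .
qed

lemma nn_integral_scaled_kernel: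
  fixes x :: "'a::euclidean_space"
  assumes r: "0 < r"
  shows "(\<integral>\<^sup>+y. ennreal (min ((norm (x - y) / r)\<^sup>2) 1 / norm (x - y) powr (real DIM('a) + 2 * s)) \<partial>lborel)
    = ennreal (r powr (- (2 * s))) * kernel_mass TYPE('a) s"
proof -
  let ?p = "real DIM('a) + 2 * s"
  let ?k = "\<lambda>y. ennreal (min ((norm (x - y) / r)\<^sup>2) 1 / norm (x - y) powr ?p)"
  have "(\<integral>\<^sup>+y. ?k y \<partial>lborel) =
      (\<integral>\<^sup>+y. ?k y \<partial>density (distr lborel borel (\<lambda>w. x + r *\<^sub>R w)) (\<lambda>_. ennreal (\<bar>r\<bar> ^ DIM('a))))"
    using lborel_affine[of r x] r by simp
  also have "\<dots> = (\<integral>\<^sup>+w. ennreal (r ^ DIM('a)) * ?k (x + r *\<^sub>R w) \<partial>lborel)"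
    using r by (simp add: nn_integral_density nn_integral_distr)
  also have "\<dots> = (\<integral>\<^sup>+w. ennreal (r powr (- (2 * s))) * ennreal (scale_kernel s (w::'a)) \<partial>lborel)"
  proof (rule nn_integral_cong)
    fix w :: 'a
    have "r ^ DIM('a) / (r * norm w) powr ?p = r powr (- (2 * s)) / norm w powr ?p"
      using r by (simp add: powr_mult powr_add powr_realpow powr_minus_divide)
    then have "min ((norm w)\<^sup>2) 1 * (r ^ DIM('a) / (r * norm w) powr ?p) =
        min ((norm w)\<^sup>2) 1 * (r powr (- (2 * s)) / norm w powr ?p)"
      by simp
    then have "r ^ DIM('a) * (min ((r * norm w / r)\<^sup>2) 1 / (r * norm w) powr ?p) =
        r powr (- (2 * s)) * scale_kernel s w"
      using r by (simp add: scale_kernel_def mult_ac)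
    then show "ennreal (r ^ DIM('a)) * ?k (x + r *\<^sub>R w) =
        ennreal (r powr (- (2 * s))) * ennreal (scale_kernel s w)"
      using r by (simp add: ennreal_mult'[symmetric])
  qed
  also have "\<dots> = ennreal (r powr (- (2 * s))) * kernel_mass TYPE('a) s"
    by (simp add: nn_integral_cmult kernel_mass_def)
  finally show ?thesis .
qed

text \<open>
  For each \<open>x\<close> the inner integral is enlarged to the whole space, where scaling by \<open>r\<close> turns it into
  \<open>r powr (- 2 s)\<close> times a constant. The bound depends on \<open>f\<close> only through its height \<open>B\<close> and its
  scale \<open>r\<close>; hence it applies to a sum of many disjoint tents without accounting for the interaction
  of different tents in the double integral.
\<close>
lemma gagliardo_sq_le:
  fixes X :: "'a::euclidean_space set"
  assumes X: "X \<in> sets borel" and r: "0 < r" and B: "0 \<le> B"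
    and osc: "\<And>x y. \<bar>f x - f y\<bar> \<le> B * min (norm (x - y) / r) 1"
  shows "gagliardo_sq s X f \<le>
    ennreal (B\<^sup>2 * r powr (- (2 * s))) * kernel_mass TYPE('a) s * emeasure lborel X"
proof -
  let ?p = "real DIM('a) + 2 * s" and ?X = "restrict_space lborel X"
  let ?k = "\<lambda>x y. ennreal (min ((norm (x - y) / r)\<^sup>2) 1 / norm (x - y) powr ?p)"
  interpret X: sigma_finite_measure ?X
    using X by (intro sigma_finite_measure_restrict_space sigma_finite_lborel) simp
  have id: "(\<lambda>x. x) \<in> ?X \<rightarrow>\<^sub>M borel" by (rule measurable_restrict_space1) simp
  have [measurable]: "fst \<in> ?X \<Otimes>\<^sub>M ?X \<rightarrow>\<^sub>M borel" "snd \<in> ?X \<Otimes>\<^sub>M ?X \<rightarrow>\<^sub>M borel"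
    using measurable_compose[OF measurable_fst id] measurable_compose[OF measurable_snd id] by auto
  have "gagliardo_sq s X f \<le> (\<integral>\<^sup>+p. ennreal (B\<^sup>2) * ?k (fst p) (snd p) \<partial>(?X \<Otimes>\<^sub>M ?X))"
    unfolding gagliardo_sq_def
  proof (rule nn_integral_mono, unfold case_prod_beta)
    fix q :: "'a \<times> 'a"
    obtain x y where q: "q = (x, y)" by fastforce
    have "\<bar>f x - f y\<bar>\<^sup>2 \<le> (B * min (norm (x - y) / r) 1)\<^sup>2"
      using osc by (intro power_mono) auto
    also have "\<dots> = B\<^sup>2 * min ((norm (x - y) / r)\<^sup>2) 1"
      using r by (auto simp: power_mult_distrib min_def power_le_one_iff field_simps)
    finally show "ennreal (\<bar>f (fst q) - f (snd q)\<bar>\<^sup>2 / norm (fst q - snd q) powr ?p)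
        \<le> ennreal (B\<^sup>2) * ?k (fst q) (snd q)"
      by (auto simp: q ennreal_mult'[symmetric] intro!: ennreal_leI divide_right_mono)
  qed
  also have "\<dots> = ennreal (B\<^sup>2) * (\<integral>\<^sup>+p. ?k (fst p) (snd p) \<partial>(?X \<Otimes>\<^sub>M ?X))"
    by (rule nn_integral_cmult) measurable
  also have "(\<integral>\<^sup>+p. ?k (fst p) (snd p) \<partial>(?X \<Otimes>\<^sub>M ?X)) = (\<integral>\<^sup>+x. \<integral>\<^sup>+y. ?k x y \<partial>?X \<partial>?X)"
    by (subst X.nn_integral_fst[symmetric]) simp_all
  also have "\<dots> \<le> (\<integral>\<^sup>+x. ennreal (r powr (- (2 * s))) * kernel_mass TYPE('a) s \<partial>?X)"
  proof (rule nn_integral_mono)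
    fix x
    have "(\<integral>\<^sup>+y. ?k x y \<partial>?X) \<le> (\<integral>\<^sup>+y. ?k x y \<partial>lborel)"
      using X by (subst nn_integral_restrict_space) (auto intro!: nn_integral_mono simp: indicator_def)
    then show "(\<integral>\<^sup>+y. ?k x y \<partial>?X) \<le> ennreal (r powr (- (2 * s))) * kernel_mass TYPE('a) s"
      by (simp add: nn_integral_scaled_kernel[OF r])
  qed
  also have "\<dots> = ennreal (r powr (- (2 * s))) * kernel_mass TYPE('a) s * emeasure lborel X"
    using X by (simp add: emeasure_restrict_space space_restrict_space)
  finally show ?thesis
    by (simp add: ennreal_mult' mult.assoc mult_left_mono)
qed

section \<open>Sums of disjoint tents\<close>

definition tent :: "real \<Rightarrow> 'a::euclidean_space \<Rightarrow> 'a \<Rightarrow> real" where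
  "tent r c x = max 0 (1 - norm (x - c) / r)"

definition tents :: "real \<Rightarrow> 'a::euclidean_space set \<Rightarrow> 'a \<Rightarrow> real" where
  "tents r S x = (\<Sum>c\<in>S. tent r c x)"

text \<open>
  The factor \<open>2\<close> makes the balls of radius \<open>r\<close> around the points of \<open>S\<close> pairwise disjoint.
\<close>
definition separated :: "real \<Rightarrow> 'a::euclidean_space set \<Rightarrow> bool" where
  "separated r S \<longleftrightarrow> pairwise (\<lambda>c c'. 2 * r \<le> dist c c') S"

lemma tent_measurable [measurable]: "tent r c \<in> borel_measurable borel"
  unfolding tent_def by measurable

lemma tents_measurable [measurable]: "tents r S \<in> borel_measurable borel"
  unfolding tents_def by measurable

lemma tent_nonneg: "0 \<le> tent r c x" by (simp add: tent_def)

lemma tent_le_1: "0 < r \<Longrightarrow> tent r c x \<le> 1" by (simp add: tent_def)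

lemma tent_eq_0: "0 < r \<Longrightarrow> x \<notin> ball c r \<Longrightarrow> tent r c x = 0"
  by (auto simp: tent_def dist_norm norm_minus_commute)

lemma tent_lipschitz:
  assumes "0 < r"
  shows "tent r c x \<le> tent r c y + norm (x - y) / r"
proof -
  have "norm (y - c) / r \<le> (norm (x - c) + norm (x - y)) / r"
    using assms norm_triangle_ineq[of "x - c" "y - x"]
    by (intro divide_right_mono) (simp_all add: norm_minus_commute)
  moreover have "0 \<le> norm (x - y) / r" using assms by simp
  ultimately show ?thesis
    unfolding tent_def add_divide_distrib by linarith
qed

lemma separated_subset: "separated r C \<Longrightarrow> S \<subseteq> C \<Longrightarrow> separated r S"
  unfolding separated_def by (rule pairwise_subset)

lemma separated_balls_disjoint:
  assumes "separated r C" "c \<in> C" "c' \<in> C" "c \<noteq> c'"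
  shows "ball c r \<inter> ball c' r = {}"
proof -
  have "2 * r \<le> dist c c'" using assms by (auto simp: separated_def pairwise_def)
  then show ?thesis by (intro disjoint_ballI) simp
qed

lemma tents_eq_tent:
  assumes "finite S" "separated r S" "0 < r" "c \<in> S" "x \<in> ball c r"
  shows "tents r S x = tent r c x"
proof -
  have "tent r c' x = 0" if "c' \<in> S - {c}" for c'
    using that assms separated_balls_disjoint[of r S c c'] by (intro tent_eq_0) blast+
  then show ?thesis using assms by (simp add: tents_def sum.remove[of S c])
qed

lemma tents_cases:
  assumes "finite S" "separated r S" "0 < r"
  obtains "tents r S x = 0" | c where "c \<in> S" "tents r S x = tent r c x"
proof (cases "\<exists>c\<in>S. x \<in> ball c r")
  case True
  then show ?thesis using that tents_eq_tent[OF assms] by blast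
next
  case False
  then have "tents r S x = 0"
    unfolding tents_def using tent_eq_0[OF assms(3)] by (intro sum.neutral) blast
  then show ?thesis by (rule that)
qed

lemma tents_nonneg: "0 \<le> tents r S x"
  by (simp add: tents_def sum_nonneg tent_nonneg)

lemma tents_le_1:
  assumes "finite S" "separated r S" "0 < r"
  shows "tents r S x \<le> 1"
  using assms by (rule tents_cases[of S r x]) (simp_all add: tent_le_1 assms(3))

text \<open>
  A point lies in the support of at most one tent of the sum, and the whole sum dominates this tent
  elsewhere because the tents are nonnegative. Hence the sum inherits the Lipschitz constant
  \<open>1 / r\<close> of a single tent, whatever the number of tents.
\<close>
lemma tents_oscillation:
  assumes "finite S" "separated r S" "0 < r"
  shows "\<bar>tents r S x - tents r S y\<bar> \<le> min (norm (x - y) / r) 1"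
proof -
  have lip: "tents r S x \<le> tents r S y + norm (x - y) / r" for x y
    using assms
  proof (rule tents_cases[of S r x])
    assume "tents r S x = 0"
    then show ?thesis using assms(3) by (simp add: tents_nonneg)
  next
    fix c assume c: "c \<in> S" "tents r S x = tent r c x"
    have "tent r c y \<le> tents r S y"
      unfolding tents_def using c assms by (intro member_le_sum) (auto simp: tent_nonneg)
    with c tent_lipschitz[OF assms(3), of c x y] show ?thesis by simp
  qed
  show ?thesis
    using lip[of x y] lip[of y x] tents_nonneg[of r S x] tents_nonneg[of r S y]
      tents_le_1[OF assms, of x] tents_le_1[OF assms, of y]
    by (simp add: norm_minus_commute abs_le_iff)
qed

lemma tents_flip:
  assumes "finite S"
  shows "(tents r S x - tents r (sym_diff S {c}) x)\<^sup>2 = (tent r c x)\<^sup>2"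
proof (cases "c \<in> S")
  case True
  then have "sym_diff S {c} = S - {c}" by auto
  with True assms show ?thesis by (simp add: tents_def sum.remove[of S c])
next
  case False
  then have "sym_diff S {c} = insert c S" by auto
  with False assms show ?thesis by (simp add: tents_def)
qed

text \<open>
  As \<open>r \<le> 1\<close>, the factor \<open>r powr (- 2 s)\<close> of the seminorm is at least \<open>1\<close>, which lets the \<open>L\<^sup>2\<close> part
  be absorbed: the square of the Sobolev norm is at most a constant times \<open>B\<^sup>2 r powr (- 2 s)\<close>.
\<close>
lemma tents_in_sobolev_ball:
  fixes X :: "'a::euclidean_space set"
  assumes X: "X \<in> sets borel" "emeasure lborel X < \<infinity>"
    and S: "finite S" "separated r S" and r: "0 < r" "r \<le> 1" and s: "0 < s" "s < 1"
    and B: "0 \<le> B" and M: "0 \<le> M"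
    and small: "B\<^sup>2 * measure lborel X * (1 + enn2real (kernel_mass TYPE('a) s)) \<le> M\<^sup>2 * r powr (2 * s)"
  shows "(\<lambda>x. B * tents r S x) \<in> sobolev_ball s X M"
proof -
  let ?f = "\<lambda>x. B * tents r S x" and ?V = "measure lborel X" and ?J = "enn2real (kernel_mass TYPE('a) s)"
  have J: "kernel_mass TYPE('a) s = ennreal ?J"
    using kernel_mass_finite[OF s, where 'a='a] by (simp add: less_top)
  have V: "emeasure lborel X = ennreal ?V"
    using X by (simp add: emeasure_eq_ennreal_measure less_top)
  have meas: "?f \<in> borel_measurable (restrict_space borel X)"
    by (rule measurable_restrict_space1) measurable
  have "L2_sq X ?f \<le> (\<integral>\<^sup>+x. ennreal (B\<^sup>2) \<partial>restrict_space lborel X)"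
    unfolding L2_sq_def
    by (intro nn_integral_mono ennreal_leI)
       (use tents_le_1[OF S r(1)] B in \<open>simp add: tents_nonneg power_mult_distrib mult_left_le power_le_one\<close>)
  also have "\<dots> = ennreal (B\<^sup>2 * ?V)"
    using X by (simp add: emeasure_restrict_space space_restrict_space V ennreal_mult')
  finally have L2: "L2_sq X ?f \<le> ennreal (B\<^sup>2 * ?V)" .
  have "gagliardo_sq s X ?f \<le> ennreal (B\<^sup>2 * r powr (- (2 * s))) * kernel_mass TYPE('a) s * emeasure lborel X"
  proof (rule gagliardo_sq_le)
    fix x y
    have "\<bar>B * tents r S x - B * tents r S y\<bar> = B * \<bar>tents r S x - tents r S y\<bar>"
      using B by (simp add: right_diff_distrib[symmetric] abs_mult)
    also have "\<dots> \<le> B * min (norm (x - y) / r) 1"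
      by (intro mult_left_mono tents_oscillation S r B)
    finally show "\<bar>B * tents r S x - B * tents r S y\<bar> \<le> B * min (norm (x - y) / r) 1" .
  qed (use X r B in auto)
  also have "\<dots> = ennreal (B\<^sup>2 * r powr (- (2 * s)) * ?J * ?V)"
    by (subst J, subst V) (simp add: ennreal_mult'[symmetric])
  finally have G: "gagliardo_sq s X ?f \<le> ennreal (B\<^sup>2 * r powr (- (2 * s)) * ?J * ?V)" .
  have r1: "1 \<le> r powr (- (2 * s))"
    using r s by (simp add: powr_minus_divide powr_le1)
  have "B\<^sup>2 * ?V + B\<^sup>2 * r powr (- (2 * s)) * ?J * ?V \<le>
      r powr (- (2 * s)) * (B\<^sup>2 * ?V * (1 + ?J))"
    using mult_right_mono[OF r1, of "B\<^sup>2 * ?V"] by (simp add: algebra_simps)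
  also have "\<dots> \<le> r powr (- (2 * s)) * (M\<^sup>2 * r powr (2 * s))"
    by (intro mult_left_mono small) simp
  also have "\<dots> = M\<^sup>2"
    using r by (simp add: powr_minus_divide)
  finally have bound: "L2_sq X ?f + gagliardo_sq s X ?f \<le> ennreal (M\<^sup>2)"
    using add_mono[OF L2 G] by (simp add: ennreal_plus[symmetric] order_trans[OF _ ennreal_leI] del: ennreal_plus)
  have "sobolev_norm s X ?f \<le> sqrt (M\<^sup>2)"
    unfolding sobolev_norm_def using enn2real_mono[OF bound] by (intro real_sqrt_le_mono) simp
  then have "sobolev_norm s X ?f \<le> M" using M by simp
  moreover have "L2_sq X ?f < \<infinity>" "gagliardo_sq s X ?f < \<infinity>"
    using L2 G by (auto simp: le_less_trans)
  ultimately show ?thesis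
    using meas by (simp add: sobolev_ball_def sobolev_space_def)
qed

section \<open>Packing an open set by balls\<close>

text \<open>
  The points are those of a cubic lattice of mesh \<open>2 r\<close> inside a small ball contained in \<open>X\<close>.
\<close>
lemma open_set_packing:
  fixes X :: "'a::euclidean_space set"
  assumes "open X" "X \<noteq> {}"
  shows "\<exists>l>0. \<forall>r. 0 < r \<longrightarrow> r \<le> l \<longrightarrow> (\<exists>C. finite C \<and> separated r C \<and> (\<forall>c\<in>C. ball c r \<subseteq> X) \<and>
    (l / r) ^ DIM('a) \<le> real (card C))"
proof -
  obtain p R where R: "0 < R" "ball p R \<subseteq> X"
    using assms by (meson ex_in_conv openE)
  define d where "d = real DIM('a)"
  have d: "1 \<le> d" unfolding d_def by (simp add: Suc_leI)
  \<comment> \<open>with this size, the lattice points stay within \<open>R / 2\<close> of \<open>p\<close>, and \<open>r \<le> l\<close> leaves room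
    for the balls of radius \<open>r\<close> around them\<close>
  define l where "l = R / (8 * d)"
  have "\<exists>C. finite C \<and> separated r C \<and> (\<forall>c\<in>C. ball c r \<subseteq> X) \<and> (l / r) ^ DIM('a) \<le> real (card C)"
    if r: "0 < r" "r \<le> l" for r
  proof -
    define m where "m = nat \<lfloor>2 * (l / r)\<rfloor>"
    have lr: "1 \<le> l / r" using r by simp
    have m: "l / r \<le> real m" "real m \<le> 2 * (l / r)"
      unfolding m_def using lr by linarith+
    define V where "V = PiE (Basis::'a set) (\<lambda>_. {..<m})"
    define pt where "pt v = p + (2 * r) *\<^sub>R (\<Sum>b\<in>Basis. real (v b) *\<^sub>R b)" for v :: "'a \<Rightarrow> nat"
    have sep: "2 * r \<le> dist (pt v) (pt w)" if vw: "v \<in> V" "w \<in> V" "v \<noteq> w" for v w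
    proof -
      obtain b where b: "b \<in> Basis" "v b \<noteq> w b"
        using vw unfolding V_def by (meson PiE_ext)
      have "1 \<le> \<bar>real (v b) - real (w b)\<bar>" using b(2) by linarith
      then have "2 * r * 1 \<le> 2 * r * \<bar>real (v b) - real (w b)\<bar>"
        using r by (intro mult_left_mono) auto
      also have "\<dots> = \<bar>(pt v - pt w) \<bullet> b\<bar>"
        using b r by (simp add: pt_def inner_diff_left inner_add_left abs_mult flip: right_diff_distrib)
      also have "\<dots> \<le> dist (pt v) (pt w)"
        unfolding dist_norm by (rule Basis_le_norm[OF b(1)])
      finally show ?thesis by simp
    qed
    have inj: "inj_on pt V"
      using sep r by (force intro!: inj_onI)
    have ball: "ball (pt v) r \<subseteq> X" if v: "v \<in> V" for v
    proof -
      have "dist (pt v) p = 2 * r * norm (\<Sum>b\<in>Basis. real (v b) *\<^sub>R b :: 'a)"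
        using r by (simp add: pt_def dist_norm)
      also have "\<dots> \<le> 2 * r * (\<Sum>b\<in>(Basis::'a set). real m)"
        using r v by (intro mult_left_mono sum_norm_le) (auto simp: V_def PiE_iff less_imp_le)
      also have "\<dots> = 2 * r * d * real m" by (simp add: d_def)
      also have "\<dots> \<le> 2 * r * d * (2 * (l / r))"
        using r d m by (intro mult_left_mono) auto
      also have "\<dots> = R / 2" using r d by (simp add: l_def)
      finally have "dist (pt v) p \<le> R / 2" .
      moreover have "r \<le> R / 2"
      proof -
        have "R / (8 * d) \<le> R / 2" using d R by (intro divide_left_mono) auto
        with r show ?thesis by (simp add: l_def)
      qed
      ultimately have "ball (pt v) r \<subseteq> ball p R"
        by (simp add: ball_subset_ball_iff)
      with R show ?thesis by blast
    qed
    have "(l / r) ^ DIM('a) \<le> real m ^ DIM('a)" using lr m by (intro power_mono) auto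
    also have "\<dots> = real (card (pt ` V))"
      by (subst card_image[OF inj]) (simp add: V_def card_PiE)
    finally show ?thesis
      using sep ball by (intro exI[of _ "pt ` V"]) (auto simp: V_def separated_def pairwise_def finite_PiE)
  qed
  moreover have "0 < l" using R d by (simp add: l_def)
  ultimately show ?thesis by blast
qed

section \<open>The lower bound at a fixed sample size\<close>

abbreviation uniform_law :: "'a::euclidean_space set \<Rightarrow> 'a measure" where
  "uniform_law X \<equiv> design_law X (uniform_density_on X)"

lemma sets_uniform_law [measurable_cong]: "sets (uniform_law X) = sets (restrict_space borel X)"
  by (simp add: design_law_def sets_restrict_space)

lemma measurable_uniform_law: "u \<in> borel \<rightarrow>\<^sub>M N \<Longrightarrow> u \<in> uniform_law X \<rightarrow>\<^sub>M N"
  unfolding design_law_def by (simp add: measurable_restrict_space1)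

lemma uniform_density_measurable:
  assumes [measurable]: "X \<in> sets borel"
  shows "(\<lambda>x. ennreal (uniform_density_on X x)) \<in> borel_measurable (restrict_space lborel X)"
proof (rule measurable_restrict_space1)
  show "(\<lambda>x. ennreal (uniform_density_on X x)) \<in> borel_measurable lborel"
    unfolding uniform_density_on_def measurable_lborel1 by measurable
qed

lemma nn_integral_uniform_law_eq_density:
  assumes "X \<in> sets borel" "u \<in> borel_measurable (restrict_space borel X)"
  shows "(\<integral>\<^sup>+x. ennreal (u x) \<partial>uniform_law X) =
    (\<integral>\<^sup>+x. ennreal (u x * uniform_density_on X x) \<partial>restrict_space lborel X)"
proof -
  have "u \<in> borel_measurable (restrict_space lborel X)"
    using assms(2) by (simp add: measurable_def space_restrict_space sets_restrict_space)
  then have "(\<lambda>x. ennreal (u x)) \<in> borel_measurable (restrict_space lborel X)"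
    by (rule measurable_compose) simp
  then have "(\<integral>\<^sup>+x. ennreal (u x) \<partial>uniform_law X) =
      (\<integral>\<^sup>+x. ennreal (uniform_density_on X x) * ennreal (u x) \<partial>restrict_space lborel X)"
    unfolding design_law_def using uniform_density_measurable[OF assms(1)] by (intro nn_integral_density)
  also have "\<dots> = (\<integral>\<^sup>+x. ennreal (u x * uniform_density_on X x) \<partial>restrict_space lborel X)"
    by (intro nn_integral_cong, subst ennreal_mult'') (simp_all add: uniform_density_on_def mult.commute)
  finally show ?thesis .
qed

lemma nn_integral_uniform_law:
  assumes X [measurable]: "X \<in> sets borel" and u [measurable]: "u \<in> borel_measurable borel"
  shows "(\<integral>\<^sup>+x. u x \<partial>uniform_law X) = (\<integral>\<^sup>+x. u x * indicator X x \<partial>lborel) * ennreal (1 / measure lborel X)"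
proof -
  have u': "u \<in> borel_measurable (restrict_space lborel X)"
    by (rule measurable_restrict_space1) simp
  have "(\<integral>\<^sup>+x. u x \<partial>uniform_law X) =
      (\<integral>\<^sup>+x. ennreal (uniform_density_on X x) * u x \<partial>restrict_space lborel X)"
    unfolding design_law_def using uniform_density_measurable[OF X] u' by (intro nn_integral_density)
  also have "\<dots> = (\<integral>\<^sup>+x. (u x * indicator X x) * ennreal (1 / measure lborel X) \<partial>lborel)"
    using X by (subst nn_integral_restrict_space)
      (auto intro!: nn_integral_cong simp: uniform_density_on_def indicator_def mult.commute)
  also have "\<dots> = (\<integral>\<^sup>+x. u x * indicator X x \<partial>lborel) * ennreal (1 / measure lborel X)"
    by (intro nn_integral_multc) measurable
  finally show ?thesis .
qed

lemma prob_space_uniform_law: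
  assumes "X \<in> sets borel" "emeasure lborel X < \<infinity>" "0 < measure lborel X"
  shows "prob_space (uniform_law X)"
proof (rule prob_spaceI)
  have "emeasure lborel X = ennreal (measure lborel X)"
    using assms by (simp add: emeasure_eq_ennreal_measure less_top)
  then show "emeasure (uniform_law X) (space (uniform_law X)) = 1"
    using nn_integral_uniform_law[of X "\<lambda>_. 1"] assms
    by (simp add: ennreal_mult'[symmetric])
qed

lemma emeasure_open_bounded:
  fixes X :: "'a::euclidean_space set"
  assumes "open X" "X \<noteq> {}" "bounded X"
  shows "X \<in> sets borel" "emeasure lborel X < \<infinity>" "0 < measure lborel X"
proof -
  show "X \<in> sets borel" using assms by simp
  show fin: "emeasure lborel X < \<infinity>" by (rule emeasure_bounded_finite) fact
  have "X \<notin> null_sets lborel"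
    using assms(1,2) open_not_negligible[of X] by (auto simp: negligible_iff_null_sets null_sets_completionI)
  then have "emeasure lborel X \<noteq> 0" using assms(1) by (auto simp: null_sets_def)
  then show "0 < measure lborel X"
    using fin by (simp add: measure_def enn2real_positive_iff zero_less_iff_neq_zero less_top)
qed

lemma nn_integral_tent_le:
  fixes X :: "'a::euclidean_space set"
  assumes X: "X \<in> sets borel" and r: "0 < r"
  shows "(\<integral>\<^sup>+x. ennreal ((B * tent r c x)\<^sup>2) \<partial>uniform_law X) \<le>
    ennreal (B\<^sup>2 * (unit_ball_vol (real DIM('a)) * r ^ DIM('a)) / measure lborel X)"
proof -
  have "(\<integral>\<^sup>+x. ennreal ((B * tent r c x)\<^sup>2) \<partial>uniform_law X) =
      (\<integral>\<^sup>+x. ennreal ((B * tent r c x)\<^sup>2) * indicator X x \<partial>lborel) * ennreal (1 / measure lborel X)"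
    using X by (rule nn_integral_uniform_law) measurable
  also have "\<dots> \<le> (\<integral>\<^sup>+x. ennreal (B\<^sup>2) * indicator (ball c r) x \<partial>lborel) * ennreal (1 / measure lborel X)"
  proof (intro mult_right_mono nn_integral_mono)
    fix x
    have "(B * tent r c x)\<^sup>2 \<le> B\<^sup>2"
      using tent_le_1[OF r, of c x]
      by (simp add: power_mult_distrib mult_left_le power_le_one tent_nonneg)
    then show "ennreal ((B * tent r c x)\<^sup>2) * indicator X x \<le> ennreal (B\<^sup>2) * indicator (ball c r) x"
      using tent_eq_0[OF r, of x c] by (auto simp: indicator_def ennreal_leI)
  qed simp
  also have "\<dots> = ennreal (B\<^sup>2 * (unit_ball_vol (real DIM('a)) * r ^ DIM('a)) / measure lborel X)"
    using r by (simp add: nn_integral_cmult_indicator emeasure_ball ennreal_mult'[symmetric] del: times_divide_eq_right)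
      (simp add: ennreal_mult'[symmetric])
  finally show ?thesis .
qed

text \<open>
  On the concentric ball of half the radius the tent is at least \<open>1 / 2\<close>.
\<close>
lemma nn_integral_tent_ge:
  fixes X :: "'a::euclidean_space set"
  assumes X: "X \<in> sets borel" and r: "0 < r" and c: "ball c r \<subseteq> X"
  shows "(\<integral>\<^sup>+x. ennreal ((B * tent r c x)\<^sup>2) * indicator (ball c r) x \<partial>uniform_law X) \<ge>
    ennreal (B\<^sup>2 / 4 * (unit_ball_vol (real DIM('a)) * (r / 2) ^ DIM('a)) / measure lborel X)"
proof -
  have "ennreal (B\<^sup>2 / 4 * (unit_ball_vol (real DIM('a)) * (r / 2) ^ DIM('a)) / measure lborel X) =
      (\<integral>\<^sup>+x. ennreal (B\<^sup>2 / 4) * indicator (ball c (r / 2)) x \<partial>lborel) * ennreal (1 / measure lborel X)"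
    using r by (simp add: nn_integral_cmult_indicator emeasure_ball ennreal_mult'[symmetric] del: times_divide_eq_right)
      (simp add: ennreal_mult'[symmetric])
  also have "\<dots> \<le> (\<integral>\<^sup>+x. ennreal ((B * tent r c x)\<^sup>2) * indicator (ball c r) x * indicator X x \<partial>lborel)
      * ennreal (1 / measure lborel X)"
  proof (intro mult_right_mono nn_integral_mono)
    fix x
    show "ennreal (B\<^sup>2 / 4) * indicator (ball c (r / 2)) x \<le>
        ennreal ((B * tent r c x)\<^sup>2) * indicator (ball c r) x * indicator X x"
    proof (cases "x \<in> ball c (r / 2)")
      case True
      then have n: "norm (x - c) / r \<le> 1 / 2"
        using r by (simp add: dist_norm norm_minus_commute field_simps)
      then have "1 / 2 \<le> tent r c x" unfolding tent_def by linarith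
      then have "(1 / 2)\<^sup>2 \<le> (tent r c x)\<^sup>2" by (rule power_mono) simp
      then have "B\<^sup>2 * (1 / 2)\<^sup>2 \<le> B\<^sup>2 * (tent r c x)\<^sup>2" by (rule mult_left_mono) simp
      moreover have "x \<in> ball c r" using True r by simp
      ultimately show ?thesis
        using c True by (auto simp: indicator_def power_mult_distrib power_divide intro!: ennreal_leI)
    qed simp
  qed simp
  also have "\<dots> = (\<integral>\<^sup>+x. ennreal ((B * tent r c x)\<^sup>2) * indicator (ball c r) x \<partial>uniform_law X)"
    by (intro nn_integral_uniform_law[OF X, symmetric] borel_measurable_times_ennreal borel_measurable_indicator) simp_all
  finally show ?thesis .
qed

lemma estimator_measurable:
  assumes "fhat \<in> estimators X n"
  shows "(\<lambda>(D, x). fhat D x) \<in> borel_measurable (sample_law (uniform_law X) n \<Otimes>\<^sub>M uniform_law X)"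
proof -
  have "sets (sample_law (uniform_law X) n \<Otimes>\<^sub>M uniform_law X) =
      sets ((\<Pi>\<^sub>M i\<in>{..<n}. restrict_space borel X \<Otimes>\<^sub>M borel) \<Otimes>\<^sub>M restrict_space borel X)"
    by (intro sets_pair_measure_cong sets_PiM_cong sets_uniform_law refl) simp
  then show ?thesis
    using assms by (simp add: estimators_def cong: measurable_cong_sets)
qed

text \<open>
  The integrated squared error restricted to a cell \<open>Q\<close>. It is additive over disjoint cells, which is
  what allows one two-point comparison per cell.
\<close>
definition loss_on :: "'a::euclidean_space set \<Rightarrow> 'a set \<Rightarrow> ('a \<Rightarrow> real) \<Rightarrow> ('a \<Rightarrow> real) \<Rightarrow> ennreal" where
  "loss_on X Q h f = (\<integral>\<^sup>+x. ennreal ((h x - f x)\<^sup>2) * indicator Q x \<partial>uniform_law X)"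

lemma loss_on_measurable:
  assumes X: "X \<in> sets borel" "prob_space (uniform_law X)" and fhat: "fhat \<in> estimators X n"
    and f: "f \<in> borel_measurable borel" and Q: "Q \<in> sets borel"
  shows "(\<lambda>D. loss_on X Q (fhat D) f) \<in> borel_measurable (sample_law (uniform_law X) n)"
proof -
  interpret U: prob_space "uniform_law X" by fact
  have id: "(\<lambda>x. x) \<in> uniform_law X \<rightarrow>\<^sub>M borel"
    by (rule measurable_uniform_law) simp
  have [measurable]: "(\<lambda>p. f (snd p)) \<in> borel_measurable (sample_law (uniform_law X) n \<Otimes>\<^sub>M uniform_law X)"
    "(\<lambda>p. indicator Q (snd p) :: ennreal) \<in> borel_measurable (sample_law (uniform_law X) n \<Otimes>\<^sub>M uniform_law X)"
    using measurable_compose[OF measurable_compose[OF measurable_snd id] f]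
      measurable_compose[OF measurable_compose[OF measurable_snd id] borel_measurable_indicator[OF Q]] by auto
  have [measurable]: "(\<lambda>p. fhat (fst p) (snd p)) \<in> borel_measurable (sample_law (uniform_law X) n \<Otimes>\<^sub>M uniform_law X)"
    using estimator_measurable[OF fhat] by (simp add: case_prod_beta)
  show ?thesis
    unfolding loss_on_def
    by (rule U.borel_measurable_nn_integral) (simp add: case_prod_beta)
qed

lemma risk_eq_loss_on:
  assumes X: "X \<in> sets borel" and fhat: "fhat \<in> estimators X n" and f: "f \<in> borel_measurable borel"
  shows "risk X (uniform_density_on X) n fhat f =
    (\<integral>\<^sup>+\<omega>. loss_on X UNIV (fhat (observations n f \<omega>)) f \<partial>sample_law (uniform_law X) n)"
  unfolding risk_def design_noise_law_def
proof (rule nn_integral_cong)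
  fix \<omega> assume \<omega>: "\<omega> \<in> space (sample_law (uniform_law X) n)"
  let ?D = "observations n f \<omega>"
  have f': "f \<in> borel_measurable (uniform_law X)" "f \<in> borel_measurable (restrict_space borel X)"
    using f by (auto intro: measurable_restrict_space1 measurable_uniform_law)
  have "?D \<in> space (sample_law (uniform_law X) n)"
    using measurable_space[OF observations_measurable[OF f'(1)] \<omega>] .
  then have "fhat ?D \<in> borel_measurable (uniform_law X)"
    using measurable_Pair2[OF estimator_measurable[OF fhat]] by simp
  then have "fhat ?D \<in> borel_measurable (restrict_space borel X)"
    by (simp add: measurable_cong_sets[OF sets_uniform_law refl])
  then have "(\<lambda>x. (fhat ?D x - f x)\<^sup>2) \<in> borel_measurable (restrict_space borel X)"
    using f'(2) by measurable
  then show "(\<integral>\<^sup>+x. ennreal ((fhat ?D x - f x)\<^sup>2 * uniform_density_on X x) \<partial>restrict_space lborel X) =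
      loss_on X UNIV (fhat ?D) f"
    by (simp add: loss_on_def nn_integral_uniform_law_eq_density[OF X])
qed

lemma sum_loss_on_le:
  assumes C: "finite C" "disjoint_family_on Q C"
    and meas: "\<And>c. c \<in> C \<Longrightarrow> (\<lambda>x. ennreal ((h x - f x)\<^sup>2) * indicator (Q c) x) \<in> borel_measurable (uniform_law X)"
  shows "(\<Sum>c\<in>C. loss_on X (Q c) h f) \<le> loss_on X UNIV h f"
proof -
  have "(\<Sum>c\<in>C. loss_on X (Q c) h f) =
      (\<integral>\<^sup>+x. (\<Sum>c\<in>C. ennreal ((h x - f x)\<^sup>2) * indicator (Q c) x) \<partial>uniform_law X)"
    unfolding loss_on_def using meas by (simp add: nn_integral_sum)
  also have "\<dots> \<le> loss_on X UNIV h f"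
    unfolding loss_on_def
  proof (rule nn_integral_mono)
    fix x
    have "(\<Sum>c\<in>C. indicator (Q c) x :: ennreal) = indicator (\<Union>c\<in>C. Q c) x"
      using C by (simp add: indicator_UN_disjoint)
    also have "\<dots> \<le> 1" by (simp add: indicator_def)
    finally show "(\<Sum>c\<in>C. ennreal ((h x - f x)\<^sup>2) * indicator (Q c) x) \<le> ennreal ((h x - f x)\<^sup>2) * indicator UNIV x"
      by (simp add: sum_distrib_left[symmetric] mult_left_le)
  qed
  finally show ?thesis .
qed

text \<open>
  The parallelogram inequality \<open>(f - f')\<^sup>2 \<le> 2 ((h - f)\<^sup>2 + (h - f')\<^sup>2)\<close>, integrated over the cell.
\<close>
lemma loss_on_separation:
  assumes meas: "(\<lambda>x. ennreal ((h x - f x)\<^sup>2) * indicator Q x) \<in> borel_measurable (uniform_law X)"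
    "(\<lambda>x. ennreal ((h x - f' x)\<^sup>2) * indicator Q x) \<in> borel_measurable (uniform_law X)"
    and sep: "ennreal (2 * \<delta>) \<le> (\<integral>\<^sup>+x. ennreal ((f x - f' x)\<^sup>2) * indicator Q x \<partial>uniform_law X)"
  shows "ennreal \<delta> \<le> loss_on X Q h f + loss_on X Q h f'"
proof -
  have "ennreal 2 * ennreal \<delta> \<le> (\<integral>\<^sup>+x. ennreal ((f x - f' x)\<^sup>2) * indicator Q x \<partial>uniform_law X)"
    using sep by (simp only: ennreal_mult'[symmetric])
  also have "\<dots> \<le> (\<integral>\<^sup>+x. ennreal 2 * (ennreal ((h x - f x)\<^sup>2) * indicator Q x +
      ennreal ((h x - f' x)\<^sup>2) * indicator Q x) \<partial>uniform_law X)"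
  proof (rule nn_integral_mono)
    fix x
    have "(f x - f' x)\<^sup>2 \<le> 2 * ((h x - f x)\<^sup>2 + (h x - f' x)\<^sup>2)"
      using zero_le_power2[of "(h x - f x) + (h x - f' x)"] by (simp add: power2_eq_square algebra_simps)
    then have "ennreal ((f x - f' x)\<^sup>2) \<le> ennreal (2 * ((h x - f x)\<^sup>2 + (h x - f' x)\<^sup>2))"
      by (rule ennreal_leI)
    also have "\<dots> = ennreal 2 * (ennreal ((h x - f x)\<^sup>2) + ennreal ((h x - f' x)\<^sup>2))"
      by (subst ennreal_mult') simp_all
    finally show "ennreal ((f x - f' x)\<^sup>2) * indicator Q x \<le> ennreal 2 * (ennreal ((h x - f x)\<^sup>2) * indicator Q x +
        ennreal ((h x - f' x)\<^sup>2) * indicator Q x)"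
      by (simp add: indicator_def)
  qed
  also have "\<dots> = ennreal 2 * (loss_on X Q h f + loss_on X Q h f')"
    unfolding loss_on_def using meas by (simp add: nn_integral_cmult nn_integral_add)
  finally show ?thesis by (subst (asm) ennreal_mult_le_mult_iff) simp_all
qed

text \<open>
  The hypotheses are the sums of tents of height \<open>B\<close> over the subsets of \<open>C\<close>. The condition
  \<open>smooth\<close> keeps them in the Sobolev ball; \<open>close\<close> says that the presence of a single tent cannot be
  detected reliably from \<open>n\<close> observations. Adding or removing the tent at \<open>c\<close> changes the function only on the
  ball around \<open>c\<close>, so each cell carries its own two-point problem, and the pairing argument adds up
  the losses of all cells.
\<close>
lemma risk_lower_bound:
  fixes X :: "'a::euclidean_space set"
  assumes X: "open X" "X \<noteq> {}" "bounded X" and s: "0 < s" "s < 1"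
    and r: "0 < r" "r \<le> 1"
    and C: "finite C" "separated r C" "\<And>c. c \<in> C \<Longrightarrow> ball c r \<subseteq> X"
    and B: "0 \<le> B" and M: "0 \<le> M"
    and smooth: "B\<^sup>2 * measure lborel X * (1 + enn2real (kernel_mass TYPE('a) s)) \<le> M\<^sup>2 * r powr (2 * s)"
    and close: "real n * (B\<^sup>2 * (unit_ball_vol (real DIM('a)) * r ^ DIM('a)) / measure lborel X) \<le> 4"
    and fhat: "fhat \<in> estimators X n"
  shows "\<exists>f\<in>sobolev_ball s X M.
    ennreal (real (card C) * (B\<^sup>2 * (unit_ball_vol (real DIM('a)) * (r / 2) ^ DIM('a)) / (128 * measure lborel X)))
      \<le> risk X (uniform_density_on X) n fhat f"
proof -
  let ?U = "uniform_law X"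
  let ?P = "sample_law ?U n"
  let ?\<omega> = "unit_ball_vol (real DIM('a))"
  note X' = emeasure_open_bounded[OF X]
  have U: "prob_space ?U" by (rule prob_space_uniform_law) (rule X')+
  define f where "f S x = B * tents r S x" for S and x :: 'a
  define \<delta> where "\<delta> = B\<^sup>2 * (?\<omega> * (r / 2) ^ DIM('a)) / (8 * measure lborel X)"
  have \<delta>: "0 \<le> \<delta>" using r X'(3) by (simp add: \<delta>_def)
  have f_meas: "f S \<in> borel_measurable borel" for S unfolding f_def by measurable
  have f_meas_U: "f S \<in> borel_measurable ?U" for S
    by (rule measurable_uniform_law[OF f_meas])
  have f_flip: "(f S x - f (sym_diff S {c}) x)\<^sup>2 = (B * tent r c x)\<^sup>2" if "S \<subseteq> C" for S c x
    using tents_flip[of S r x c] finite_subset[OF that C(1)]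
    by (simp add: f_def power_mult_distrib flip: right_diff_distrib)
  have loss_meas: "(\<lambda>D. loss_on X Q (fhat D) (f S)) \<in> borel_measurable ?P" if "Q \<in> sets borel" for Q S
    by (rule loss_on_measurable[OF X'(1) U fhat f_meas that])
  have integrand_meas: "(\<lambda>x. ennreal ((fhat D x - f S x)\<^sup>2) * indicator (ball c r) x) \<in> borel_measurable ?U"
    if D: "D \<in> space ?P" for D S c
  proof -
    have [measurable]: "fhat D \<in> borel_measurable ?U"
      using measurable_Pair2[OF estimator_measurable[OF fhat] D] by simp
    have [measurable]: "(\<lambda>x. indicator (ball c r) x :: ennreal) \<in> borel_measurable ?U"
      by (intro measurable_uniform_law borel_measurable_indicator) simp
    have [measurable]: "f S \<in> borel_measurable ?U" by (rule f_meas_U)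
    show ?thesis by measurable
  qed
  have obs_space: "observations n (f S) \<omega> \<in> space ?P" if "\<omega> \<in> space ?P" for S \<omega>
    using measurable_space[OF observations_measurable[OF f_meas_U] that] .
  let ?r = "\<lambda>c S. \<integral>\<^sup>+\<omega>. loss_on X (ball c r) (fhat (observations n (f S) \<omega>)) (f S) \<partial>?P"
  have "\<exists>S\<subseteq>C. of_nat (card C) * (ennreal \<delta> * ennreal (1 / 8) / 2) \<le> risk X (uniform_density_on X) n fhat (f S)"
  proof (rule assouad_pairing[OF C(1), where r="?r"])
    fix S assume S: "S \<subseteq> C"
    have "(\<Sum>c\<in>C. ?r c S) = (\<integral>\<^sup>+\<omega>. (\<Sum>c\<in>C. loss_on X (ball c r) (fhat (observations n (f S) \<omega>)) (f S)) \<partial>?P)"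
      by (intro nn_integral_sum[symmetric] measurable_compose[OF observations_measurable[OF f_meas_U] loss_meas]) simp
    also have "\<dots> \<le> (\<integral>\<^sup>+\<omega>. loss_on X UNIV (fhat (observations n (f S) \<omega>)) (f S) \<partial>?P)"
      using C separated_balls_disjoint[OF C(2)]
      by (intro nn_integral_mono sum_loss_on_le integrand_meas obs_space)
         (auto simp: disjoint_family_on_def)
    also have "\<dots> = risk X (uniform_density_on X) n fhat (f S)"
      by (rule risk_eq_loss_on[OF X'(1) fhat f_meas, symmetric])
    finally show "(\<Sum>c\<in>C. ?r c S) \<le> risk X (uniform_density_on X) n fhat (f S)" .
  next
    fix c S assume c: "c \<in> C" and S: "S \<subseteq> C"
    let ?S = "sym_diff S {c}"
    show "ennreal \<delta> * ennreal (1 / 8) \<le> ?r c S + ?r c ?S"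
    proof (rule two_point_lower_bound[OF U f_meas_U f_meas_U _ close])
      show "(\<integral>\<^sup>+x. ennreal ((f S x - f ?S x)\<^sup>2) \<partial>?U) \<le>
          ennreal (B\<^sup>2 * (?\<omega> * r ^ DIM('a)) / measure lborel X)"
        unfolding f_flip[OF S] by (rule nn_integral_tent_le[OF X'(1) r(1)])
      fix D assume D: "D \<in> space ?P"
      show "ennreal \<delta> \<le> loss_on X (ball c r) (fhat D) (f S) + loss_on X (ball c r) (fhat D) (f ?S)"
      proof (rule loss_on_separation[OF integrand_meas[OF D] integrand_meas[OF D]], unfold f_flip[OF S])
        have "2 * \<delta> = B\<^sup>2 / 4 * (?\<omega> * (r / 2) ^ DIM('a)) / measure lborel X"
          by (simp add: \<delta>_def)
        then show "ennreal (2 * \<delta>) \<le> (\<integral>\<^sup>+x. ennreal ((B * tent r c x)\<^sup>2) * indicator (ball c r) x \<partial>?U)"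
          using nn_integral_tent_ge[OF X'(1) r(1) C(3)[OF c], of B] by simp
      qed
    qed (simp_all add: loss_meas)
  qed
  then obtain S where S: "S \<subseteq> C"
    "of_nat (card C) * (ennreal \<delta> * ennreal (1 / 8) / 2) \<le> risk X (uniform_density_on X) n fhat (f S)"
    by blast
  have "f S \<in> sobolev_ball s X M"
    unfolding f_def
    using finite_subset[OF S(1) C(1)] separated_subset[OF C(2) S(1)]
    by (intro tents_in_sobolev_ball X' r s B M smooth)
  moreover have "of_nat (card C) * (ennreal \<delta> * ennreal (1 / 8) / 2) = ennreal (real (card C) * (\<delta> / 16))"
  proof -
    have "ennreal \<delta> * ennreal (1 / 8) / 2 = ennreal (\<delta> * (1 / 8)) / ennreal 2"
      using \<delta> by (subst ennreal_mult) simp_all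
    also have "\<dots> = ennreal (\<delta> / 16)"
      using \<delta> by (subst divide_ennreal) simp_all
    finally show ?thesis
      by (simp only: ennreal_mult' of_nat_0_le_iff ennreal_of_nat_eq_real_of_nat)
  qed
  moreover have "\<delta> / 16 = B\<^sup>2 * (?\<omega> * (r / 2) ^ DIM('a)) / (128 * measure lborel X)"
    by (simp add: \<delta>_def)
  ultimately show ?thesis using S(2) by auto
qed

section \<open>Choice of the scale\<close>

text \<open>
  The largest height that \<open>tents_in_sobolev_ball\<close> allows is given by
  \<open>B\<^sup>2 = \<kappa> M\<^sup>2 r powr (2 s)\<close>, and the largest radius that keeps neighbouring hypotheses indistinguishable solves \<open>n M\<^sup>2 r powr (2 s + d) = A\<close>. There are
  about \<open>(l / r) ^ d\<close> cells, each of which contributes about \<open>B\<^sup>2 r ^ d\<close>, so the risk is of order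
  \<open>B\<^sup>2\<close>, which is the claimed rate. The constant depends on \<open>X\<close> and \<open>s\<close> only: \<open>M\<close> only affects how
  large \<open>n\<close> must be for the balls of radius \<open>r\<close> to fit into \<open>X\<close>.
\<close>
lemma minimax_lower_bound:
  fixes X :: "'a::euclidean_space set" and s :: real
  assumes X: "open X" "X \<noteq> {}" "bounded X" and s: "0 < s" "s < 1"
  shows "\<exists>c>0. \<forall>M>0. eventually (\<lambda>n. \<forall>fhat\<in>estimators X n. \<exists>f\<in>sobolev_ball s X M.
    ennreal (c * (M powr (2 * real DIM('a) / (2 * s + real DIM('a))) *
      real n powr (- (2 * s / (2 * s + real DIM('a)))))) \<le> risk X (uniform_density_on X) n fhat f) sequentially"
proof -
  define d where "d = real DIM('a)"
  define \<omega> where "\<omega> = unit_ball_vol d"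
  define V where "V = measure lborel X"
  define \<kappa> where "\<kappa> = 1 / (V * (1 + enn2real (kernel_mass TYPE('a) s)))"
  define A where "A = 4 * V / (\<kappa> * \<omega>)"
  define e where "e = 2 * s + d"
  define q where "q = 2 * s / e"
  have d: "1 \<le> d" unfolding d_def by (simp add: Suc_leI)
  have e: "0 < e" using s d by (simp add: e_def)
  have V: "0 < V" unfolding V_def by (rule emeasure_open_bounded[OF X])
  have \<omega>: "0 < \<omega>" using d by (simp add: \<omega>_def)
  have J: "0 < 1 + enn2real (kernel_mass TYPE('a) s)" by (simp add: add_pos_nonneg)
  have \<kappa>: "0 < \<kappa>" using V J by (simp add: \<kappa>_def)
  have A: "0 < A" using V \<kappa> \<omega> by (simp add: A_def)
  obtain l where l: "0 < l" and packing: "\<And>r. 0 < r \<Longrightarrow> r \<le> l \<Longrightarrow>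
      \<exists>C. finite C \<and> separated r C \<and> (\<forall>c\<in>C. ball c r \<subseteq> X) \<and> (l / r) ^ DIM('a) \<le> real (card C)"
    using open_set_packing[OF X(1,2)] by blast
  define c where "c = (l / 2) ^ DIM('a) * \<kappa> * A powr q * \<omega> / (128 * V)"
  have "0 < c" using l \<kappa> A \<omega> V by (simp add: c_def)
  moreover have "eventually (\<lambda>n. \<forall>fhat\<in>estimators X n. \<exists>f\<in>sobolev_ball s X M.
    ennreal (c * (M powr (2 * real DIM('a) / (2 * s + real DIM('a))) *
      real n powr (- (2 * s / (2 * s + real DIM('a)))))) \<le> risk X (uniform_density_on X) n fhat f) sequentially"
    if M: "0 < M" for M
  proof -
    define r where "r n = (A / (real n * M\<^sup>2)) powr (1 / e)" for n :: nat
    have "((\<lambda>n. (A / (real n * M\<^sup>2)) powr (1 / e)) \<longlongrightarrow> 0 powr (1 / e)) sequentially"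
    proof (rule tendsto_powr')
      have "((\<lambda>n. A / M\<^sup>2 * (1 / real n)) \<longlongrightarrow> A / M\<^sup>2 * 0) sequentially"
        by (intro tendsto_mult tendsto_const lim_1_over_n)
      then show "((\<lambda>n. A / (real n * M\<^sup>2)) \<longlongrightarrow> 0) sequentially" by (simp add: mult.commute)
    qed (use A e in \<open>auto intro!: always_eventually\<close>)
    then have "(r \<longlongrightarrow> 0) sequentially" by (simp add: r_def[abs_def])
    then have "eventually (\<lambda>n. r n < min l 1) sequentially"
      using l by (intro order_tendstoD(2)) auto
    then show ?thesis
      using eventually_gt_at_top[of 0]
    proof eventually_elim
      case (elim n)
      then have n: "0 < real n" by simp
      have r: "0 < r n" "r n \<le> l" "r n \<le> 1" using elim A M n by (auto simp: r_def)
      define B where "B = sqrt (\<kappa> * M\<^sup>2 * r n powr (2 * s))"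
      have B2: "B\<^sup>2 = \<kappa> * M\<^sup>2 * r n powr (2 * s)" using \<kappa> by (simp add: B_def)
      obtain C where C: "finite C" "separated (r n) C" "\<And>c. c \<in> C \<Longrightarrow> ball c (r n) \<subseteq> X"
        "(l / r n) ^ DIM('a) \<le> real (card C)"
        using packing[OF r(1,2)] by blast
      have smooth: "B\<^sup>2 * V * (1 + enn2real (kernel_mass TYPE('a) s)) \<le> M\<^sup>2 * r n powr (2 * s)"
        using V J by (simp add: B2 \<kappa>_def)
      have "r n powr (2 * s) * r n ^ DIM('a) = r n powr e"
        using r by (simp add: e_def d_def powr_add powr_realpow)
      also have "\<dots> = A / (real n * M\<^sup>2)"
        using e A n M by (simp add: r_def powr_powr)
      finally have re: "r n powr (2 * s) * r n ^ DIM('a) = A / (real n * M\<^sup>2)" .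
      have "real n * (B\<^sup>2 * (\<omega> * r n ^ DIM('a)) / V) =
          real n * M\<^sup>2 * \<kappa> * \<omega> / V * (r n powr (2 * s) * r n ^ DIM('a))"
        by (simp add: B2)
      also have "\<dots> = 4"
        unfolding re A_def using n M V \<kappa> \<omega> by simp
      finally have close: "real n * (B\<^sup>2 * (\<omega> * r n ^ DIM('a)) / V) \<le> 4" by simp
      have r2s: "M\<^sup>2 * r n powr (2 * s) = A powr q * (M powr (2 * d / e) * real n powr (- q))"
      proof -
        have "r n powr (2 * s) = (A / (real n * M\<^sup>2)) powr q"
          by (simp add: r_def powr_powr q_def)
        also have "\<dots> = A powr q * real n powr (- q) * (M powr 2) powr (- q)"
          using A n M by (simp add: powr_divide powr_mult powr_minus_divide)
        also have "\<dots> = A powr q * real n powr (- q) * M powr (- 2 * q)"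
          by (simp add: powr_powr)
        finally have "M\<^sup>2 * r n powr (2 * s) = A powr q * real n powr (- q) * (M powr 2 * M powr (- 2 * q))"
          using M by simp
        also have "M powr 2 * M powr (- 2 * q) = M powr (2 * d / e)"
        proof -
          have "2 + - 2 * q = 2 * d / e" using e by (simp add: q_def field_simps) (simp add: e_def)
          then show ?thesis by (simp only: powr_add[symmetric])
        qed
        finally show ?thesis by (simp add: mult_ac)
      qed
      have "c * (M powr (2 * d / e) * real n powr (- q)) =
          (l / r n) ^ DIM('a) * (B\<^sup>2 * (\<omega> * (r n / 2) ^ DIM('a)) / (128 * V))"
      proof -
        have "(l / r n) ^ DIM('a) * (r n / 2) ^ DIM('a) = (l / 2) ^ DIM('a)"
          using r by (simp flip: power_mult_distrib)
        then have "(l / r n) ^ DIM('a) * (B\<^sup>2 * (\<omega> * (r n / 2) ^ DIM('a)) / (128 * V)) =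
            (l / 2) ^ DIM('a) * \<kappa> * \<omega> / (128 * V) * (M\<^sup>2 * r n powr (2 * s))"
          by (simp add: B2 mult_ac)
        then show ?thesis unfolding r2s c_def by (simp only:) (simp add: mult_ac)
      qed
      also have "\<dots> \<le> real (card C) * (B\<^sup>2 * (\<omega> * (r n / 2) ^ DIM('a)) / (128 * V))"
        using C(4) r \<omega> V by (intro mult_right_mono) simp_all
      finally have rate: "c * (M powr (2 * d / e) * real n powr (- q)) \<le>
          real (card C) * (B\<^sup>2 * (\<omega> * (r n / 2) ^ DIM('a)) / (128 * V))" .
      show ?case
      proof
        fix fhat assume "fhat \<in> estimators X n"
        then obtain f where "f \<in> sobolev_ball s X M"
          "ennreal (real (card C) * (B\<^sup>2 * (\<omega> * (r n / 2) ^ DIM('a)) / (128 * V))) \<le>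
            risk X (uniform_density_on X) n fhat f"
          using risk_lower_bound[OF X s r(1,3) C(1-3), of B M n fhat] \<kappa> M smooth close
          by (auto simp: B_def V_def \<omega>_def d_def)
        then show "\<exists>f\<in>sobolev_ball s X M.
            ennreal (c * (M powr (2 * real DIM('a) / (2 * s + real DIM('a))) *
              real n powr (- (2 * s / (2 * s + real DIM('a)))))) \<le> risk X (uniform_density_on X) n fhat f"
          using ennreal_leI[OF rate] unfolding d_def e_def q_def by (meson order_trans)
      qed
    qed
  qed
  ultimately show ?thesis by blast
qed

lemma liminf_minimax_risk_ge:
  assumes "eventually (\<lambda>n. \<forall>fhat\<in>E n. \<exists>f\<in>F. ennreal (c * a n) \<le> R n fhat f) sequentially"
    and "eventually (\<lambda>n. 0 < a n) sequentially" and "0 \<le> c"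
  shows "ennreal c \<le> liminf (\<lambda>n. INF fhat\<in>E n. SUP f\<in>F. R n fhat f / ennreal (a n))"
proof (rule Liminf_bounded)
  show "eventually (\<lambda>n. ennreal c \<le> (INF fhat\<in>E n. SUP f\<in>F. R n fhat f / ennreal (a n))) sequentially"
    using assms(1,2)
  proof eventually_elim
    case (elim n)
    show ?case
    proof (rule INF_greatest)
      fix fhat assume "fhat \<in> E n"
      with elim obtain f where f: "f \<in> F" "ennreal (c * a n) \<le> R n fhat f" by blast
      have "ennreal c = ennreal (c * a n) / ennreal (a n)"
        using elim assms(3) by (subst divide_ennreal) simp_all
      also have "\<dots> \<le> R n fhat f / ennreal (a n)"
        by (rule divide_right_mono_ennreal) fact
      also have "\<dots> \<le> (SUP f\<in>F. R n fhat f / ennreal (a n))"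
        by (rule SUP_upper) fact
      finally show "ennreal c \<le> (SUP f\<in>F. R n fhat f / ennreal (a n))" .
    qed
  qed
qed

theorem theorem3p9:
  fixes X :: "'a::euclidean_space set" and s :: real
  assumes "X \<noteq> {}" and "open X" and "connected X" and "bounded X" and "lipschitz_boundary X"
    and "0 < s" and "s < 1"
  shows "(\<forall>M>0. lower_minimax_rate X (uniform_density_on X) (sobolev_ball s X M)
            (\<lambda>n. real n powr (- (2 * s / (2 * s + real DIM('a)))))) \<and>
         (\<exists>C\<^sub>1::real>0. \<forall>M>0.
            liminf (\<lambda>n. INF fhat\<in>estimators X n. SUP f\<in>sobolev_ball s X M.
              risk X (uniform_density_on X) n fhat f /
              ennreal (M powr (2 * real DIM('a) / (2 * s + real DIM('a))) *
                       real n powr (- (2 * s / (2 * s + real DIM('a))))))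
            \<ge> ennreal C\<^sub>1)"
proof -
  let ?b = "\<lambda>M. M powr (2 * real DIM('a) / (2 * s + real DIM('a)))"
    and ?a = "\<lambda>n. real n powr (- (2 * s / (2 * s + real DIM('a))))"
  obtain c where c: "0 < c" and bound: "\<And>M. 0 < M \<Longrightarrow> eventually (\<lambda>n. \<forall>fhat\<in>estimators X n.
      \<exists>f\<in>sobolev_ball s X M. ennreal (c * (?b M * ?a n)) \<le> risk X (uniform_density_on X) n fhat f) sequentially"
    using minimax_lower_bound[OF assms(2,1,4,6,7)] by blast
  have a: "eventually (\<lambda>n. 0 < ?a n) sequentially"
    using eventually_gt_at_top[of 0] by eventually_elim simp
  have "lower_minimax_rate X (uniform_density_on X) (sobolev_ball s X M) ?a" if M: "0 < M" for M
  proof -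
    have "0 < ennreal (c * ?b M)" using c M by simp
    also have "\<dots> \<le> liminf (\<lambda>n. INF fhat\<in>estimators X n. SUP f\<in>sobolev_ball s X M.
        risk X (uniform_density_on X) n fhat f / ennreal (?a n))"
      using bound[OF M] a c by (intro liminf_minimax_risk_ge) (simp_all add: mult.assoc)
    finally show ?thesis unfolding lower_minimax_rate_def .
  qed
  moreover have "ennreal c \<le> liminf (\<lambda>n. INF fhat\<in>estimators X n. SUP f\<in>sobolev_ball s X M.
      risk X (uniform_density_on X) n fhat f / ennreal (?b M * ?a n))" if M: "0 < M" for M
  proof (rule liminf_minimax_risk_ge[OF bound[OF M]])
    show "eventually (\<lambda>n. 0 < ?b M * ?a n) sequentially"
      using a by eventually_elim (use M in simp)
  qed (use c in simp)
  ultimately show ?thesis using c by blast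
qed

end
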